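(* Let $(\xi_n)_{n\ge 1}$ be the sequence of nonzero zeros of the entire function $F$ in $\mathbb{C}$ (the projections to $\mathbb{C}$ of the wavenumber bound states and resonances), counted with multiplicity. Then $$\sum_n \frac{|\operatorname{Re}\xi_n|}{|\xi_n|^2}<\infty .$$
   Context: Setting. Fix $\omega>0$, $H>0$ and real functions $\lambda,\mu\in C^3((-\infty,0])$ with $\mu\ge\alpha_0>0$, $2\mu+3\lambda\ge\beta_0>0$ for some constants $\alpha_0,\beta_0$, and $\lambda(Z)=\lambda_0$, $\mu(Z)=\mu_0$ (constants) for $Z<-H$. Put $\sigma_0=\lambda_0+2\mu_0$. For $\xi\in\mathbb{C}$ the Rayleigh system for $\psi=(\psi_1,\psi_2)^{T}$ on $Z<0$ is $$(P\psi')'+\xi\,(N\psi'-(N^{T}\psi)')+(\omega^2 I-\xi^2M)\psi=0,$$ with $P=\begin{pmatrix}\mu&0\\0&\lambda+2\mu\end{pmatrix}$, $M=\begin{pmatrix}\lambda+2\mu&0\\0&\mu\end{pmatrix}$, $N=\begin{pmatrix}0&-\lambda\\ \mu&0\end{pmatrix}$, $'=d/dZ$. Riemann surface. $\mathcal{R}$ is the four-fold cover of $\mathbb{C}$ on which $q_P=\sqrt{\omega^2/\sigma_0-\xi^2}$ and $q_S=\sqrt{\omega^2/\mu_0-\xi^2}$ are single-valued; a point of $\mathcal{R}$ is a triple $(\xi,q_P,q_S)$ with $q_P^2=\omega^2/\sigma_0-\xi^2$, $q_S^2=\omega^2/\mu_0-\xi^2$, and is denoted simply by $\xi$. The maps $w_P,w_S,w_{PS}:\mathcal{R}\to\mathcal{R}$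 keep the complex number $\xi$ and act by $w_P:(q_P,q_S)\mapsto(-q_P,q_S)$, $w_S:(q_P,q_S)\mapsto(q_P,-q_S)$, $w_{PS}:(q_P,q_S)\mapsto(-q_P,-q_S)$. Jost solutions. $\psi_P^\pm,\psi_S^\pm$ are the solutions of the Rayleigh system which for $Z\le -H$ equal $$\psi_P^\pm=\begin{pmatrix}-\xi\\ \pm i q_P\end{pmatrix}e^{\pm iZq_P},\qquad \psi_S^\pm=\begin{pmatrix}\pm i q_S\\ -\xi\end{pmatrix}e^{\pm iZq_S}.$$ Boundary tractions: $\hat a(\psi)=i\big(\lambda(0^-)\xi\psi_1(0^-)+(\lambda(0^-)+2\mu(0^-))\psi_2'(0^-)\big)$, $\hat b(\psi)=-\xi\mu(0^-)\psi_2(0^-)+\mu(0^-)\psi_1'(0^-)$. The boundary matrix is $\mathcal{B}=\begin{pmatrix}\hat a(\psi_P^-)&\hat a(\psi_S^-)\\ \hat b(\psi_P^-)&\hat b(\psi_S^-)\end{pmatrix}$ and the Rayleigh determinant is $\Delta=\det\mathcal{B}$, a function on $\mathcal{R}$. Its zeros on $\mathcal{R}$ are the wavenumber resonances (those on the sheet $\operatorname{Im}q_P>0$, $\operatorname{Im}q_S>0$ being the bound states). The function $F(\xi)=\Delta(\xi)\Delta(w_S(\xi))\Delta(w_P(\xi))\Delta(w_{PS}(\xi))$ depends only on the complex number $\xi$ and is entire on $\mathbb{C}$. *)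

theory Defs
  imports "HOL-Complex_Analysis.Complex_Analysis"
begin

definition C3_on :: "real set \<Rightarrow> (real \<Rightarrow> real) \<Rightarrow> bool" where
  "C3_on S f \<longleftrightarrow> (\<exists>f1 f2 f3.
     (\<forall>x\<in>S. (f has_real_derivative f1 x) (at x within S)) \<and>
     (\<forall>x\<in>S. (f1 has_real_derivative f2 x) (at x within S)) \<and>
     (\<forall>x\<in>S. (f2 has_real_derivative f3 x) (at x within S)) \<and>
     continuous_on S f3)"

definition P_mat :: "(real \<Rightarrow> real) \<Rightarrow> (real \<Rightarrow> real) \<Rightarrow> real \<Rightarrow> complex^2^2" where
  "P_mat lam mu Z = vector [vector [of_real (mu Z), 0],
                            vector [0, of_real (lam Z + 2 * mu Z)]]"

definition M_mat :: "(real \<Rightarrow> real) \<Rightarrow> (real \<Rightarrow> real) \<Rightarrow> real \<Rightarrow> complex^2^2" where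
  "M_mat lam mu Z = vector [vector [of_real (lam Z + 2 * mu Z), 0],
                            vector [0, of_real (mu Z)]]"

definition N_mat :: "(real \<Rightarrow> real) \<Rightarrow> (real \<Rightarrow> real) \<Rightarrow> real \<Rightarrow> complex^2^2" where
  "N_mat lam mu Z = vector [vector [0, - of_real (lam Z)],
                            vector [of_real (mu Z), 0]]"

definition vderiv :: "(real \<Rightarrow> 'a::real_normed_vector) \<Rightarrow> real \<Rightarrow> 'a" where
  "vderiv f Z = vector_derivative f (at Z)"

text \<open>Differentiability is required of \<open>\<psi>\<close> and \<open>P \<psi>'\<close> only: with \<open>C\<^sup>3\<close> coefficients
  it then follows for \<open>N\<^sup>T \<psi>\<close>.\<close>

definition rayleigh_solution ::
    "real \<Rightarrow> (real \<Rightarrow> real) \<Rightarrow> (real \<Rightarrow> real) \<Rightarrow> complex \<Rightarrow> (real \<Rightarrow> complex^2) \<Rightarrow> bool" where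
  "rayleigh_solution \<omega> lam mu \<xi> \<psi> \<longleftrightarrow> (\<forall>Z<0.
     \<psi> differentiable (at Z) \<and>
     (\<lambda>t. P_mat lam mu t *v vderiv \<psi> t) differentiable (at Z) \<and>
     vderiv (\<lambda>t. P_mat lam mu t *v vderiv \<psi> t) Z
       + \<xi> *s (N_mat lam mu Z *v vderiv \<psi> Z
               - vderiv (\<lambda>t. transpose (N_mat lam mu t) *v \<psi> t) Z)
       + (mat (of_real (\<omega>\<^sup>2)) - mat (\<xi>\<^sup>2) ** M_mat lam mu Z) *v \<psi> Z = 0)"

text \<open>A point of the four-fold cover is a triple \<open>(\<xi>, q\<^sub>P, q\<^sub>S)\<close>.\<close>

type_synonym rpoint = "complex \<times> complex \<times> complex"

definition riemann_surface :: "real \<Rightarrow> real \<Rightarrow> real \<Rightarrow> rpoint set" where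
  "riemann_surface \<omega> lam0 mu0 = {(\<xi>, qP, qS).
     qP\<^sup>2 = of_real (\<omega>\<^sup>2 / (lam0 + 2 * mu0)) - \<xi>\<^sup>2 \<and>
     qS\<^sup>2 = of_real (\<omega>\<^sup>2 / mu0) - \<xi>\<^sup>2}"

fun w_P :: "rpoint \<Rightarrow> rpoint" where "w_P (\<xi>, qP, qS) = (\<xi>, - qP, qS)"
fun w_S :: "rpoint \<Rightarrow> rpoint" where "w_S (\<xi>, qP, qS) = (\<xi>, qP, - qS)"
fun w_PS :: "rpoint \<Rightarrow> rpoint" where "w_PS (\<xi>, qP, qS) = (\<xi>, - qP, - qS)"

text \<open>The Jost solutions \<open>\<psi>\<^sub>P\<^sup>-\<close> and \<open>\<psi>\<^sub>S\<^sup>-\<close>. The conditions determine them only on \<open>Z < 0\<close>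
  (values for \<open>Z \<ge> 0\<close> are arbitrary), hence \<open>SOME\<close> rather than \<open>THE\<close>.\<close>

fun jost_P_minus ::
    "real \<Rightarrow> real \<Rightarrow> (real \<Rightarrow> real) \<Rightarrow> (real \<Rightarrow> real) \<Rightarrow> rpoint \<Rightarrow> real \<Rightarrow> complex^2" where
  "jost_P_minus \<omega> H lam mu (\<xi>, qP, qS) = (SOME \<psi>. rayleigh_solution \<omega> lam mu \<xi> \<psi> \<and>
     (\<forall>Z\<le>-H. \<psi> Z = exp (- (\<i> * of_real Z * qP)) *s vector [- \<xi>, - (\<i> * qP)]))"

fun jost_S_minus ::
    "real \<Rightarrow> real \<Rightarrow> (real \<Rightarrow> real) \<Rightarrow> (real \<Rightarrow> real) \<Rightarrow> rpoint \<Rightarrow> real \<Rightarrow> complex^2" where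
  "jost_S_minus \<omega> H lam mu (\<xi>, qP, qS) = (SOME \<psi>. rayleigh_solution \<omega> lam mu \<xi> \<psi> \<and>
     (\<forall>Z\<le>-H. \<psi> Z = exp (- (\<i> * of_real Z * qS)) *s vector [- (\<i> * qS), - \<xi>]))"

definition left0 :: "(real \<Rightarrow> 'a::t2_space) \<Rightarrow> 'a" where
  "left0 f = Lim (at_left 0) f"

definition traction_a ::
    "(real \<Rightarrow> real) \<Rightarrow> (real \<Rightarrow> real) \<Rightarrow> complex \<Rightarrow> (real \<Rightarrow> complex^2) \<Rightarrow> complex" where
  "traction_a lam mu \<xi> \<psi> = \<i> * (of_real (left0 lam) * \<xi> * left0 (\<lambda>Z. \<psi> Z $ 1)
     + of_real (left0 lam + 2 * left0 mu) * left0 (\<lambda>Z. vderiv (\<lambda>t. \<psi> t $ 2) Z))"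

definition traction_b ::
    "(real \<Rightarrow> real) \<Rightarrow> complex \<Rightarrow> (real \<Rightarrow> complex^2) \<Rightarrow> complex" where
  "traction_b mu \<xi> \<psi> = - \<xi> * of_real (left0 mu) * left0 (\<lambda>Z. \<psi> Z $ 2)
     + of_real (left0 mu) * left0 (\<lambda>Z. vderiv (\<lambda>t. \<psi> t $ 1) Z)"

definition boundary_matrix ::
    "real \<Rightarrow> real \<Rightarrow> (real \<Rightarrow> real) \<Rightarrow> (real \<Rightarrow> real) \<Rightarrow> rpoint \<Rightarrow> complex^2^2" where
  "boundary_matrix \<omega> H lam mu p =
     (let \<xi> = fst p; \<psi>P = jost_P_minus \<omega> H lam mu p; \<psi>S = jost_S_minus \<omega> H lam mu p in
      vector [vector [traction_a lam mu \<xi> \<psi>P, traction_a lam mu \<xi> \<psi>S],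
              vector [traction_b mu \<xi> \<psi>P, traction_b mu \<xi> \<psi>S]])"

definition rayleigh_det ::
    "real \<Rightarrow> real \<Rightarrow> (real \<Rightarrow> real) \<Rightarrow> (real \<Rightarrow> real) \<Rightarrow> rpoint \<Rightarrow> complex" where
  "rayleigh_det \<omega> H lam mu p = det (boundary_matrix \<omega> H lam mu p)"

text \<open>The product over the four sheets does not depend on the point chosen above \<open>\<xi>\<close>
  (lemma \<open>rayleigh_F_eq\<close> below), so evaluating it at principal square roots is harmless.\<close>

definition rayleigh_F ::
    "real \<Rightarrow> real \<Rightarrow> real \<Rightarrow> real \<Rightarrow> (real \<Rightarrow> real) \<Rightarrow> (real \<Rightarrow> real) \<Rightarrow> complex \<Rightarrow> complex" where
  "rayleigh_F \<omega> H lam0 mu0 lam mu \<xi> =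
     (let p = (\<xi>, csqrt (of_real (\<omega>\<^sup>2 / (lam0 + 2 * mu0)) - \<xi>\<^sup>2),
                  csqrt (of_real (\<omega>\<^sup>2 / mu0) - \<xi>\<^sup>2));
          \<Delta> = rayleigh_det \<omega> H lam mu
      in \<Delta> p * \<Delta> (w_S p) * \<Delta> (w_P p) * \<Delta> (w_PS p))"

lemma rayleigh_F_eq:
  assumes "p \<in> riemann_surface \<omega> lam0 mu0"
  shows "rayleigh_F \<omega> H lam0 mu0 lam mu (fst p) =
    rayleigh_det \<omega> H lam mu p * rayleigh_det \<omega> H lam mu (w_S p)
    * rayleigh_det \<omega> H lam mu (w_P p) * rayleigh_det \<omega> H lam mu (w_PS p)"
proof -
  obtain \<xi> qP qS where p: "p = (\<xi>, qP, qS)" by (cases p)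
  define rP where "rP = csqrt (of_real (\<omega>\<^sup>2 / (lam0 + 2 * mu0)) - \<xi>\<^sup>2)"
  define rS where "rS = csqrt (of_real (\<omega>\<^sup>2 / mu0) - \<xi>\<^sup>2)"
  have "qP\<^sup>2 = rP\<^sup>2" "qS\<^sup>2 = rS\<^sup>2"
    using assms unfolding p rP_def rS_def riemann_surface_def by auto
  then have "qP = rP \<or> qP = - rP" "qS = rS \<or> qS = - rS"
    by (auto simp: power2_eq_iff)
  then show ?thesis
    unfolding rayleigh_F_def Let_def p fst_conv rP_def[symmetric] rS_def[symmetric]
    by (elim disjE) (simp_all add: mult_ac)
qed

end

theory Submission
  imports Defs
begin

text \<open>In the variables \<open>\<psi>\<^sub>1, \<psi>\<^sub>2, (\<lambda> + 2 \<mu>) (\<psi>\<^sub>2' + \<xi> \<psi>\<^sub>1), \<mu> (\<psi>\<^sub>1' + \<xi> \<psi>\<^sub>2)\<close> the Rayleigh system is a first-order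
  system linear in \<open>\<xi>\<close>. Weighting the first two by \<open>1 + |\<xi>|\<close> gives an energy whose logarithmic
  derivative is at most \<open>2 |Re \<xi>| + C \<surd>(1 + |\<xi>|)\<close>; the square root comes from the coincidence of the
  two characteristic speeds to leading order. Hence \<open>F\<close> is entire and bounded on the whole plane by
  \<open>exp (C (1 + |Re \<xi>| + \<surd>|\<xi>|))\<close>. In the half-plane \<open>Re \<xi> > 0\<close> it becomes bounded after
  multiplication by \<open>exp (- C (1 + \<xi> + 2 \<surd>(1 + \<xi>)))\<close>, so that its zeros there satisfy the Blaschke condition;
  the left half-plane follows by reflection. That \<open>F\<close> is not identically zero is seen at \<open>\<xi> = 0\<close>, where
  the system decouples.\<close>

text \<open>The square root is essential: sin obeys exp |\<xi>|, yet its zeros n pi violate the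
  conclusion, so a plain Gronwall estimate of a system with coefficients of size |\<xi>| would not
  suffice. The third and fourth variables are, up to constant factors, the moduli times the
  divergence and the curl of the displacement. With the boundary tractions in their place, which
  differ by 2 mu \<xi> times a displacement component, the system would contain \<xi>^2. In the
  chosen variables the leading part is a swap matrix times -\<xi> for the displacements and times
  \<xi> for the other pair; swap matrices are Hermitian, so only Re \<xi> enters the growth. The
  remaining coupling has size |\<xi>| in one direction and 1 in the other, and the weight balances
  the two at their geometric mean. As a further gain, the P wave has zero curl and the S wave zero
  divergence below -H. The Blaschke condition is obtained from finitely many zeros at a time, tested
  at a single point, so neither boundary values nor a factorization theorem is involved.\<close>

no_notation fps_nth (infixl \<open>$\<close> 75)

section \<open>Zeros of entire functions of restricted growth\<close>

text \<open>\<open>zor_poly\<close> is controlled only near \<open>a\<close> and the quotient only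
  away from \<open>a\<close>; they agree on the overlap and glue to an entire cofactor. If
  \<open>a\<close> is not a zero, the order is 0 and nothing is divided out.\<close>

lemma entire_factor_zero:
  assumes hol: "f holomorphic_on UNIV" and nz: "f x0 \<noteq> 0"
  obtains g where "g holomorphic_on UNIV" "g a \<noteq> 0" "\<And>w. f w = (w - a) ^ nat (zorder f a) * g w"
proof -
  define n where "n = nat (zorder f a)"
  obtain r where r: "r > 0" "zor_poly f a holomorphic_on cball a r"
      "\<forall>w\<in>cball a r. f w = zor_poly f a w * (w - a) ^ n \<and> zor_poly f a w \<noteq> 0"
    using zorder_exist_zero[OF hol open_UNIV connected_UNIV UNIV_I] nz unfolding n_def by auto
  define g where "g w = (if w = a then zor_poly f a a else f w / (w - a) ^ n)" for w
  have g_eq: "g w = zor_poly f a w" if "w \<in> ball a r" for w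
    using r(1,3) that by (auto simp: g_def)
  have "g holomorphic_on ball a r"
    by (rule holomorphic_transform[OF holomorphic_on_subset[OF r(2) ball_subset_cball]])
      (simp add: g_eq)
  moreover have "g holomorphic_on - {a}"
  proof (rule holomorphic_transform)
    show "(\<lambda>w. f w / (w - a) ^ n) holomorphic_on - {a}"
      by (intro holomorphic_intros holomorphic_on_subset[OF hol]) auto
  qed (auto simp: g_def)
  ultimately have "g holomorphic_on ball a r \<union> - {a}"
    by (intro holomorphic_on_Un) auto
  moreover have "ball a r \<union> - {a} = UNIV"
    using r(1) by auto
  ultimately have "g holomorphic_on UNIV" by simp
  moreover have "g a \<noteq> 0"
    using r by (auto simp: g_def)
  moreover have "f w = (w - a) ^ n * g w" for w
    using r(1,3) by (cases "w = a") (auto simp: g_def)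
  ultimately show thesis
    using that n_def by blast
qed

lemma entire_factor_zeros:
  assumes "finite S" and hol: "f holomorphic_on UNIV" and nz: "f x0 \<noteq> 0"
  shows "\<exists>g. g holomorphic_on UNIV \<and> (\<forall>w. f w = (\<Prod>z\<in>S. (w - z) ^ nat (zorder f z)) * g w)"
  using \<open>finite S\<close>
proof (induction S)
  case empty
  then show ?case using hol by auto
next
  case (insert a S)
  define P where "P w = (\<Prod>z\<in>S. (w - z) ^ nat (zorder f z))" for w
  obtain g where g: "g holomorphic_on UNIV" "\<And>w. f w = P w * g w"
    using insert.IH unfolding P_def by auto
  have "g x0 \<noteq> 0" using nz g(2)[of x0] by auto
  define m where "m = nat (zorder g a)"
  obtain h where h: "h holomorphic_on UNIV" "h a \<noteq> 0" "\<And>w. g w = (w - a) ^ m * h w"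
    using entire_factor_zero[OF g(1) \<open>g x0 \<noteq> 0\<close>] unfolding m_def by metis
  have Ph: "(\<lambda>w. P w * h w) holomorphic_on UNIV"
    unfolding P_def by (intro holomorphic_intros h)
  have "P a \<noteq> 0"
    unfolding P_def using insert.hyps by auto
  \<comment> \<open>The zeros removed so far do not include \<open>a\<close>, so dividing by
    \<open>P\<close> has not changed the order there: the exponent read off from \<open>g\<close> is
    the one prescribed by \<open>f\<close>.\<close>
  have "zorder f a = int m"
  proof (rule zorder_eqI[OF open_UNIV UNIV_I Ph])
    show "P a * h a \<noteq> 0" using \<open>P a \<noteq> 0\<close> h(2) by simp
    show "f w = P w * h w * (w - a) powi int m" if "w \<noteq> a" for w
      by (simp add: g(2) h(3))
  qed
  then have "f w = (\<Prod>z\<in>insert a S. (w - z) ^ nat (zorder f z)) * h w" for w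
    using insert.hyps by (simp add: g(2) h(3) P_def)
  then show ?case using h(1) by blast
qed

text \<open>Division by a Blaschke factor of the half-plane keeps the supremum: this is the Schwarz
  lemma after the Cayley transform \<open>u \<mapsto> (a + cnj a * u) / (1 - u)\<close>, which pulls the factor
  back to \<open>u\<close>.\<close>

lemma blaschke_factor_bound:
  assumes a: "Re a > 0" and hol: "k holomorphic_on {w. Re w > 0}"
    and bd: "\<And>w. Re w > 0 \<Longrightarrow> cmod ((w - a) / (w + cnj a) * k w) \<le> M"
    and w: "Re w > 0"
  shows "cmod (k w) \<le> M"
proof -
  define \<phi> where "\<phi> u = (a + cnj a * u) / (1 - u)" for u
  have Re\<phi>: "Re (\<phi> u) > 0" if "cmod u < 1" for u
  proof -
    have "u \<noteq> 1" using that by auto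
    then have "0 < (cmod (1 - u))\<^sup>2" by simp
    have "(a + cnj a * u) * cnj (1 - u) = \<phi> u * ((1 - u) * cnj (1 - u))"
      using \<open>u \<noteq> 1\<close> by (simp add: \<phi>_def)
    also have "(1 - u) * cnj (1 - u) = complex_of_real ((cmod (1 - u))\<^sup>2)"
      by (simp only: complex_norm_square)
    finally have "Re ((a + cnj a * u) * cnj (1 - u)) = Re (\<phi> u) * (cmod (1 - u))\<^sup>2"
      by simp
    moreover have "Re ((a + cnj a * u) * cnj (1 - u)) = Re a * (1 - (cmod u)\<^sup>2)"
      unfolding cmod_power2 by (simp add: algebra_simps power2_eq_square)
    moreover have "(cmod u)\<^sup>2 < 1"
      using that by (simp add: abs_square_less_1)
    then have "Re a * (1 - (cmod u)\<^sup>2) > 0"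
      using a by simp
    ultimately have "0 < Re (\<phi> u) * (cmod (1 - u))\<^sup>2" by linarith
    then show ?thesis
      using \<open>0 < (cmod (1 - u))\<^sup>2\<close> by (simp only: zero_less_mult_pos2)
  qed
  have hol\<phi>: "(k \<circ> \<phi>) holomorphic_on ball 0 1"
  proof (rule holomorphic_on_compose_gen[OF _ hol])
    show "\<phi> holomorphic_on ball 0 1"
      unfolding \<phi>_def by (intro holomorphic_intros) auto
    show "\<phi> ` ball 0 1 \<subseteq> {w. Re w > 0}"
      using Re\<phi> by auto
  qed
  have factor: "(\<phi> u - a) / (\<phi> u + cnj a) = u" if "cmod u < 1" for u
  proof -
    have "u \<noteq> 1" using that by auto
    have "a + cnj a \<noteq> 0"
      using a by (simp add: complex_eq_iff)
    have "\<phi> u - a = u * (a + cnj a) / (1 - u)" "\<phi> u + cnj a = (a + cnj a) / (1 - u)"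
      using \<open>u \<noteq> 1\<close> by (simp_all add: \<phi>_def field_simps)
    then show ?thesis
      using \<open>u \<noteq> 1\<close> \<open>a + cnj a \<noteq> 0\<close> by simp
  qed
  have uk: "cmod u * cmod (k (\<phi> u)) \<le> M" if "cmod u < 1" for u
    using bd[OF Re\<phi>[OF that]] factor[OF that] by (simp add: norm_mult)
  define u0 where "u0 = (w - a) / (w + cnj a)"
  have "w + cnj a \<noteq> 0"
    using a w by (auto simp: complex_eq_iff)
  have "w = \<phi> u0"
  proof -
    have "1 - u0 = (a + cnj a) / (w + cnj a)" "a + cnj a * u0 = w * (a + cnj a) / (w + cnj a)"
      using \<open>w + cnj a \<noteq> 0\<close> by (simp_all add: u0_def field_simps)
    moreover have "a + cnj a \<noteq> 0"
      using a by (simp add: complex_eq_iff)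
    ultimately show ?thesis
      using \<open>w + cnj a \<noteq> 0\<close> by (simp add: \<phi>_def)
  qed
  have "cmod u0 < 1"
  proof -
    have "(cmod (w - a))\<^sup>2 < (cmod (w + cnj a))\<^sup>2"
      unfolding cmod_power2 using mult_pos_pos[OF a w] by (simp add: power2_eq_square algebra_simps)
    then have "cmod (w - a) < cmod (w + cnj a)"
      by (rule power2_less_imp_less) simp
    then show ?thesis
      using \<open>w + cnj a \<noteq> 0\<close> by (simp add: u0_def norm_divide)
  qed
  \<comment> \<open>On the circle |u| = r the bound \<open>uk\<close> says |k (\<phi> u)| \<le> M /
    r, and the maximum principle carries it to \<open>u0\<close>. Letting r tend to 1 afterwards
    avoids any boundary values of \<open>k\<close>.\<close>
  have le: "r * cmod (k w) \<le> M" if "cmod u0 < r" "r < 1" for r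
  proof -
    have "0 < r" using that(1) by (meson le_less_trans norm_ge_zero)
    have "cmod ((k \<circ> \<phi>) u0) \<le> M / r"
    proof (rule maximum_modulus_frontier[where f = "k \<circ> \<phi>" and S = "ball 0 r"])
      show "(k \<circ> \<phi>) holomorphic_on interior (ball 0 r)"
        by (rule holomorphic_on_subset[OF hol\<phi>]) (use that in auto)
      show "continuous_on (closure (ball 0 r)) (k \<circ> \<phi>)"
        by (rule continuous_on_subset[OF holomorphic_on_imp_continuous_on[OF hol\<phi>]])
          (use \<open>0 < r\<close> that in auto)
      show "cmod ((k \<circ> \<phi>) z) \<le> M / r" if "z \<in> frontier (ball 0 r)" for z
        using uk[of z] that \<open>0 < r\<close> \<open>r < 1\<close> by (auto simp: field_simps)
    qed (use that in auto)
    then show ?thesis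
      using \<open>0 < r\<close> \<open>w = \<phi> u0\<close> by (simp add: field_simps)
  qed
  show ?thesis
  proof (rule tendsto_upperbound)
    show "((\<lambda>r. r * cmod (k w)) \<longlongrightarrow> cmod (k w)) (at_left 1)"
      by (auto intro!: tendsto_eq_intros)
    show "\<forall>\<^sub>F r in at_left 1. r * cmod (k w) \<le> M"
      using eventually_at_left_real[OF \<open>cmod u0 < 1\<close>] by eventually_elim (auto intro: le)
  qed auto
qed

text \<open>Factors are stripped one at a time, the remaining ones being absorbed into
  \<open>k\<close>; this is why the induction is over arbitrary \<open>k\<close>. The constant
  \<open>M\<close> does not deteriorate because a Blaschke factor has modulus 1 on the
  boundary.\<close>

lemma blaschke_product_bound:
  assumes "finite S" and S: "\<And>z. z \<in> S \<Longrightarrow> Re z > 0" and hol: "k holomorphic_on {w. Re w > 0}"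
    and bd: "\<And>w. Re w > 0 \<Longrightarrow> cmod ((\<Prod>z\<in>S. ((w - z) / (w + cnj z)) ^ n z) * k w) \<le> M"
    and w: "Re w > 0"
  shows "cmod (k w) \<le> M"
  using \<open>finite S\<close> S hol bd w
proof (induction S arbitrary: k w)
  case empty
  then show ?case by simp
next
  case (insert a S)
  have a: "Re a > 0" using insert.prems by auto
  have nz: "w + cnj a \<noteq> 0" if "Re w > 0" for w
    using a that by (auto simp: complex_eq_iff)
  have pow: "cmod (k w) \<le> M"
    if "k holomorphic_on {w. Re w > 0}"
      "\<And>w. Re w > 0 \<Longrightarrow> cmod (((w - a) / (w + cnj a)) ^ m * k w) \<le> M" "Re w > 0" for m k w
    using that
  proof (induction m arbitrary: k w)
    case 0
    then show ?case by simp
  next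
    case (Suc m)
    have "cmod ((w - a) / (w + cnj a) * k w) \<le> M" if "Re w > 0" for w
    proof (rule Suc.IH[OF _ _ that])
      show "(\<lambda>w. (w - a) / (w + cnj a) * k w) holomorphic_on {w. Re w > 0}"
        using nz by (intro holomorphic_intros Suc.prems) auto
    qed (use Suc.prems(2) in \<open>simp add: mult_ac\<close>)
    then show ?case
      using blaschke_factor_bound[OF a Suc.prems(1)] Suc.prems(3) by blast
  qed
  have "cmod (((w - a) / (w + cnj a)) ^ n a * k w) \<le> M" if "Re w > 0" for w
  proof (rule insert.IH[OF _ _ _ that])
    show "(\<lambda>w. ((w - a) / (w + cnj a)) ^ n a * k w) holomorphic_on {w. Re w > 0}"
      using nz by (intro holomorphic_intros insert.prems) auto
    show "cmod ((\<Prod>z\<in>S. ((w - z) / (w + cnj z)) ^ n z) * (((w - a) / (w + cnj a)) ^ n a * k w)) \<le> M"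
      if "Re w > 0" for w
      using insert.prems(3)[OF that] insert.hyps by (simp add: mult_ac)
  qed (use insert.prems in auto)
  then show ?case
    using pow insert.prems by blast
qed

text \<open>On the imaginary axis only exp (C sqrt |z|) is allowed, whose logarithm is integrable
  against dy / (1 + y^2); a Blaschke condition tolerates such growth. The square root absorbs
  polynomial factors and the summand 1 absorbs constants, so the class is closed under ring
  operations.\<close>

definition tame :: "(complex \<Rightarrow> complex) \<Rightarrow> bool" where
  "tame f \<longleftrightarrow> (\<exists>C. \<forall>z. cmod (f z) \<le> exp (C * (1 + \<bar>Re z\<bar> + sqrt (cmod z))))"

lemma tame_bound_nonneg:
  assumes "tame f"
  obtains C where "C \<ge> 0" "\<And>z. cmod (f z) \<le> exp (C * (1 + \<bar>Re z\<bar> + sqrt (cmod z)))"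
proof -
  obtain C where C: "\<And>z. cmod (f z) \<le> exp (C * (1 + \<bar>Re z\<bar> + sqrt (cmod z)))"
    using assms unfolding tame_def by blast
  have "cmod (f z) \<le> exp (max C 0 * (1 + \<bar>Re z\<bar> + sqrt (cmod z)))" for z
    by (rule order_trans[OF C]) (simp add: mult_right_mono)
  then show thesis using that[of "max C 0"] by simp
qed

text \<open>In the half-plane \<open>csqrt (1 + w)\<close> has argument at most pi/4 in modulus, so
  its real part is at least sqrt (|1 + w| / 2), and twice that dominates sqrt |w|. The shift by 1
  keeps the argument of \<open>csqrt\<close> off the branch cut.\<close>

lemma tame_bounded_mult_exp:
  assumes "tame f"
  obtains E where "E holomorphic_on {w. Re w > 0}" "\<And>w. E w \<noteq> 0"
    "\<And>w. Re w > 0 \<Longrightarrow> cmod (f w * E w) \<le> 1"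
proof -
  obtain C where C: "C \<ge> 0" "\<And>z. cmod (f z) \<le> exp (C * (1 + \<bar>Re z\<bar> + sqrt (cmod z)))"
    using tame_bound_nonneg[OF assms] by blast
  define E where "E w = exp (- (of_real C * (1 + w + 2 * csqrt (1 + w))))" for w
  have "1 + w \<notin> \<real>\<^sub>\<le>\<^sub>0" if "Re w > 0" for w
    using that by (auto simp: complex_nonpos_Reals_iff)
  then have "E holomorphic_on {w. Re w > 0}"
    unfolding E_def by (intro holomorphic_intros) auto
  moreover have "cmod (f w * E w) \<le> 1" if w: "Re w > 0" for w
  proof -
    have "(cmod w)\<^sup>2 \<le> (cmod (1 + w))\<^sup>2"
      unfolding cmod_power2 using w by (simp add: power2_eq_square algebra_simps)
    then have "cmod w \<le> cmod (1 + w)"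
      by (rule power2_le_imp_le) simp
    then have "sqrt (cmod w) \<le> sqrt (4 * ((cmod (1 + w) + Re (1 + w)) / 2))"
      using w \<open>cmod w \<le> cmod (1 + w)\<close> by (intro real_sqrt_le_mono) (simp, smt (verit) norm_ge_zero)
    also have "\<dots> = 2 * Re (csqrt (1 + w))"
      unfolding real_sqrt_mult by simp
    finally have "C * (1 + \<bar>Re w\<bar> + sqrt (cmod w)) \<le> C * (1 + Re w + 2 * Re (csqrt (1 + w)))"
      using w C(1) by (intro mult_left_mono) auto
    then have "cmod (f w) \<le> exp (C * (1 + Re w + 2 * Re (csqrt (1 + w))))"
      using C(2)[of w] by (meson exp_le_cancel_iff order_trans)
    moreover have "cmod (E w) = inverse (exp (C * (1 + Re w + 2 * Re (csqrt (1 + w)))))"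
      unfolding E_def by (simp add: exp_minus[symmetric] norm_exp_eq_Re del: csqrt.sel)
    ultimately have "cmod (f w * E w) \<le> exp (C * (1 + Re w + 2 * Re (csqrt (1 + w))))
        * inverse (exp (C * (1 + Re w + 2 * Re (csqrt (1 + w)))))"
      unfolding norm_mult by (intro mult_mono) simp_all
    then show ?thesis
      by (simp del: csqrt.sel)
  qed
  moreover have "E w \<noteq> 0" for w
    unfolding E_def by simp
  ultimately show thesis
    using that by blast
qed

text \<open>One minus the squared modulus of the factor is 4 x Re z / |x + cnj z|^2, where |x + cnj
  z| \<le> 2 |z|; then 1 - t \<le> exp (-t) applies. In this way a Blaschke product at the single
  point \<open>x\<close> controls the sum of Re z / |z|^2.\<close>

lemma blaschke_factor_le_exp:
  assumes "Re z > 0" "x > 0" "x \<le> cmod z"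
  shows "cmod ((of_real x - z) / (of_real x + cnj z)) \<le> exp (- (x / 2 * (Re z / (cmod z)\<^sup>2)))"
proof -
  define D where "D = (cmod (of_real x + cnj z))\<^sup>2"
  have nz: "z \<noteq> 0" using assms by auto
  have "of_real x + cnj z \<noteq> 0" using assms by (auto simp: complex_eq_iff)
  then have D: "D > 0" by (simp add: D_def)
  have "cmod (of_real x + cnj z) \<le> x + cmod z"
    using norm_triangle_ineq[of "of_real x" "cnj z"] assms by simp
  then have "D \<le> (2 * cmod z)\<^sup>2"
    unfolding D_def using assms by (intro power_mono) auto
  then have "1 / (4 * (cmod z)\<^sup>2) \<le> 1 / D"
    using D nz by (intro divide_left_mono) (auto simp: power_mult_distrib)
  then have "4 * x * Re z * (1 / (4 * (cmod z)\<^sup>2)) \<le> 4 * x * Re z * (1 / D)"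
    using assms by (intro mult_left_mono) auto
  then have le: "x * (Re z / (cmod z)\<^sup>2) \<le> 4 * x * Re z / D"
    by simp
  have "(cmod (of_real x - z))\<^sup>2 = D - 4 * x * Re z"
    unfolding D_def cmod_power2 by (simp add: power2_eq_square algebra_simps)
  then have "(cmod ((of_real x - z) / (of_real x + cnj z)))\<^sup>2 = 1 + - (4 * x * Re z / D)"
    using D unfolding norm_divide power_divide D_def[symmetric] by (simp add: field_simps)
  also have "\<dots> \<le> exp (- (4 * x * Re z / D))"
    by (rule exp_ge_add_one_self)
  also have "\<dots> \<le> exp (- (x * (Re z / (cmod z)\<^sup>2)))"
    using le by simp
  also have "\<dots> = (exp (- (x / 2 * (Re z / (cmod z)\<^sup>2))))\<^sup>2"
    by (simp add: power2_eq_square flip: exp_add)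
  finally show ?thesis
    by (rule power2_le_imp_le) simp
qed

text \<open>Multiplicities enter as any exponents \<open>n\<close> with which \<open>f\<close>
  factors, not as \<open>zorder\<close>. The left half-plane can then be treated by applying the
  bound to f (-w), without comparing the orders of the two functions.\<close>

lemma tame_right_zeros_sum_bound:
  assumes hol: "f holomorphic_on UNIV" and "tame f" and "f 0 \<noteq> 0"
  obtains B where "\<And>S n g. \<lbrakk>finite S; \<And>z. z \<in> S \<Longrightarrow> Re z > 0 \<and> f z = 0; g holomorphic_on UNIV;
      \<And>w. f w = (\<Prod>z\<in>S. (w - z) ^ n z) * g w\<rbrakk>
    \<Longrightarrow> (\<Sum>z\<in>S. real (n z) * (Re z / (cmod z)\<^sup>2)) \<le> B"
proof -
  obtain E where E: "E holomorphic_on {w. Re w > 0}" "\<And>w. E w \<noteq> 0"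
    "\<And>w. Re w > 0 \<Longrightarrow> cmod (f w * E w) \<le> 1"
    using tame_bounded_mult_exp[OF \<open>tame f\<close>] by blast
  have "isCont f 0"
    using hol by (simp add: holomorphic_on_imp_continuous_on continuous_on_eq_continuous_at[symmetric]
        holomorphic_on_imp_differentiable_at field_differentiable_imp_continuous_at)
  then obtain e where e: "e > 0" "\<And>z. dist 0 z < e \<Longrightarrow> f z \<noteq> 0"
    using continuous_at_avoid[of 0 f 0] \<open>f 0 \<noteq> 0\<close> by metis
  \<comment> \<open>At 0 itself every Blaschke factor has modulus 1 and carries no information. The
    product is therefore tested at an interior point, so near 0 that \<open>f\<close> is nonzero
    there and no zero of \<open>f\<close> is closer to 0 than \<open>x\<close>.\<close>
  define x where "x = e / 2"
  have x: "x > 0" "f (of_real x) \<noteq> 0"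
    using e by (auto simp: x_def)
  have far: "x \<le> cmod z" if "f z = 0" for z
    using e(2)[of z] that e(1) by (force simp: x_def)
  define c where "c = cmod (f (of_real x) * E (of_real x))"
  have c: "c > 0" using x E(2) by (simp add: c_def)
  show thesis
  proof (rule that)
    fix S and n :: "complex \<Rightarrow> nat" and g
    assume S: "finite S" "\<And>z. z \<in> S \<Longrightarrow> Re z > 0 \<and> f z = 0"
      and g: "g holomorphic_on UNIV" "\<And>w. f w = (\<Prod>z\<in>S. (w - z) ^ n z) * g w"
    \<comment> \<open>This is f E divided by the Blaschke factors of \<open>S\<close>. Writing it
      with the cofactor \<open>g\<close> avoids a division at the zeros and makes its holomorphy
      evident.\<close>
    define k where "k w = (\<Prod>z\<in>S. (w + cnj z) ^ n z) * g w * E w" for w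
    define b where "b z = (of_real x - z) / (of_real x + cnj z)" for z
    have fac: "(\<Prod>z\<in>S. ((w - z) / (w + cnj z)) ^ n z) * k w = f w * E w" if "Re w > 0" for w
    proof -
      have "w + cnj z \<noteq> 0" if "z \<in> S" for z
        using S(2)[OF that] \<open>Re w > 0\<close> by (auto simp: complex_eq_iff)
      then have "(\<Prod>z\<in>S. (w + cnj z) ^ n z) \<noteq> 0"
        using S(1) by simp
      then show ?thesis
        by (simp add: k_def g(2) power_divide prod_dividef)
    qed
    have "cmod (k (of_real x)) \<le> 1"
    proof (rule blaschke_product_bound[where k = k, OF S(1)])
      show "k holomorphic_on {w. Re w > 0}"
        unfolding k_def by (intro holomorphic_intros E holomorphic_on_subset[OF g(1)]) auto
      show "cmod ((\<Prod>z\<in>S. ((w - z) / (w + cnj z)) ^ n z) * k w) \<le> 1" if "Re w > 0" for w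
        by (simp only: fac[OF that] E(3)[OF that])
    qed (use S x in auto)
    moreover have "c = (\<Prod>z\<in>S. cmod (b z) ^ n z) * cmod (k (of_real x))"
    proof -
      have "c = cmod ((\<Prod>z\<in>S. b z ^ n z) * k (of_real x))"
        using fac[of "of_real x"] x unfolding c_def b_def by simp
      then show ?thesis
        by (simp only: norm_mult prod_norm[symmetric] norm_power)
    qed
    ultimately have "c \<le> (\<Prod>z\<in>S. cmod (b z) ^ n z)"
      by (simp add: mult_left_le prod_nonneg)
    also have "\<dots> \<le> (\<Prod>z\<in>S. exp (- (x / 2 * (Re z / (cmod z)\<^sup>2))) ^ n z)"
      unfolding b_def using S x far by (intro prod_mono conjI power_mono blaschke_factor_le_exp) auto
    also have "\<dots> = (\<Prod>z\<in>S. exp (real (n z) * - (x / 2 * (Re z / (cmod z)\<^sup>2))))"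
      by (simp only: exp_of_nat_mult)
    also have "\<dots> = exp (\<Sum>z\<in>S. real (n z) * - (x / 2 * (Re z / (cmod z)\<^sup>2)))"
      using S(1) by (simp only: exp_sum)
    also have "(\<Sum>z\<in>S. real (n z) * - (x / 2 * (Re z / (cmod z)\<^sup>2)))
        = - (x / 2 * (\<Sum>z\<in>S. real (n z) * (Re z / (cmod z)\<^sup>2)))"
      unfolding sum_distrib_left sum_negf[symmetric] by (intro sum.cong) simp_all
    finally have "ln c \<le> - (x / 2 * (\<Sum>z\<in>S. real (n z) * (Re z / (cmod z)\<^sup>2)))"
      using c by (metis ln_exp ln_le_cancel_iff exp_gt_zero)
    then show "(\<Sum>z\<in>S. real (n z) * (Re z / (cmod z)\<^sup>2)) \<le> - (2 * ln c / x)"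
      using x by (simp add: field_simps)
  qed
qed

theorem tame_zeros_summable:
  assumes hol: "f holomorphic_on UNIV" and tame: "tame f" and nz: "f 0 \<noteq> 0"
  shows "(\<lambda>z. real_of_int (zorder f z) * (\<bar>Re z\<bar> / (cmod z)\<^sup>2)) summable_on {z. f z = 0}"
proof -
  let ?t = "\<lambda>z. real_of_int (zorder f z) * (\<bar>Re z\<bar> / (cmod z)\<^sup>2)"
  define n where "n z = nat (zorder f z)" for z
  have ord: "zorder f z = int (n z)" if "f z = 0" for z
  proof -
    have "zorder f z > 0"
      using zorder_exist_zero[OF hol open_UNIV connected_UNIV UNIV_I, of z] nz that by auto
    then show ?thesis by (simp add: n_def)
  qed
  obtain B1 where B1: "\<And>S n g. \<lbrakk>finite S; \<And>z. z \<in> S \<Longrightarrow> Re z > 0 \<and> f z = 0; g holomorphic_on UNIV;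
      \<And>w. f w = (\<Prod>z\<in>S. (w - z) ^ n z) * g w\<rbrakk>
    \<Longrightarrow> (\<Sum>z\<in>S. real (n z) * (Re z / (cmod z)\<^sup>2)) \<le> B1"
    by (rule tame_right_zeros_sum_bound[OF hol tame nz]) blast
  have hol': "(\<lambda>w. f (- w)) holomorphic_on UNIV"
    using holomorphic_on_compose_gen[OF _ hol, of uminus UNIV] by (simp add: o_def holomorphic_intros)
  have tame': "tame (\<lambda>w. f (- w))"
  proof -
    obtain C where "\<And>z. cmod (f z) \<le> exp (C * (1 + \<bar>Re z\<bar> + sqrt (cmod z)))"
      using tame unfolding tame_def by blast
    from this[of "- w" for w] show ?thesis unfolding tame_def by auto
  qed
  have nz': "f (- 0) \<noteq> 0" using nz by simp
  obtain B2 where B2: "\<And>S n g. \<lbrakk>finite S; \<And>z. z \<in> S \<Longrightarrow> Re z > 0 \<and> f (- z) = 0; g holomorphic_on UNIV;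
      \<And>w. f (- w) = (\<Prod>z\<in>S. (w - z) ^ n z) * g w\<rbrakk>
    \<Longrightarrow> (\<Sum>z\<in>S. real (n z) * (Re z / (cmod z)\<^sup>2)) \<le> B2"
    by (rule tame_right_zeros_sum_bound[OF hol' tame' nz']) blast
  have right: "sum ?t S \<le> B1" if S: "finite S" "\<And>z. z \<in> S \<Longrightarrow> Re z > 0 \<and> f z = 0" for S
  proof -
    obtain g where g: "g holomorphic_on UNIV" "\<And>w. f w = (\<Prod>z\<in>S. (w - z) ^ n z) * g w"
      using entire_factor_zeros[OF S(1) hol nz] unfolding n_def by blast
    have "(\<Sum>z\<in>S. real (n z) * (Re z / (cmod z)\<^sup>2)) \<le> B1"
      by (rule B1[OF S g])
    also have "(\<Sum>z\<in>S. real (n z) * (Re z / (cmod z)\<^sup>2)) = sum ?t S"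
      using S ord by (intro sum.cong) (auto simp: abs_of_pos)
    finally show ?thesis .
  qed
  have left: "sum ?t S \<le> B2" if S: "finite S" "\<And>z. z \<in> S \<Longrightarrow> Re z < 0 \<and> f z = 0" for S
  proof -
    obtain g where g: "g holomorphic_on UNIV" "\<And>w. f w = (\<Prod>z\<in>S. (w - z) ^ n z) * g w"
      using entire_factor_zeros[OF S(1) hol nz] unfolding n_def by blast
    \<comment> \<open>Reflection turns each factor -w - z into -(w - (-z)). The signs do not depend
      on \<open>w\<close> and go into the cofactor \<open>?g\<close>.\<close>
    let ?T = "uminus ` S" and ?g = "\<lambda>w. (\<Prod>z\<in>S. (- 1) ^ n z) * g (- w)"
    have "(\<Sum>z\<in>?T. real (n (- z)) * (Re z / (cmod z)\<^sup>2)) \<le> B2"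
    proof (rule B2[where n = "\<lambda>z. n (- z)"])
      show "?g holomorphic_on UNIV"
        using holomorphic_on_compose_gen[OF _ g(1), of uminus UNIV]
        by (intro holomorphic_intros) (simp add: o_def holomorphic_intros)
      fix w
      have "f (- w) = (\<Prod>z\<in>S. (- 1) ^ n z * (w - (- z)) ^ n z) * g (- w)"
        unfolding g(2) by (simp add: power_mult_distrib[symmetric])
      also have "(\<Prod>z\<in>S. (- 1) ^ n z * (w - (- z)) ^ n z)
          = (\<Prod>z\<in>S. (- 1) ^ n z) * (\<Prod>z\<in>?T. (w - z) ^ n (- z))"
        by (simp add: prod.distrib prod.reindex)
      finally show "f (- w) = (\<Prod>z\<in>?T. (w - z) ^ n (- z)) * ?g w"
        by (simp add: mult_ac)
    qed (use S in auto)
    also have "(\<Sum>z\<in>?T. real (n (- z)) * (Re z / (cmod z)\<^sup>2)) = sum ?t S"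
      using S ord by (subst sum.reindex) (auto intro!: sum.cong simp: abs_of_neg)
    finally show ?thesis .
  qed
  show ?thesis
  proof (rule nonneg_bdd_above_summable_on)
    show "?t z \<ge> 0" if "z \<in> {z. f z = 0}" for z
      using ord that by simp
    show "bdd_above (sum ?t ` {F. F \<subseteq> {z. f z = 0} \<and> finite F})"
    proof (rule bdd_aboveI2)
      fix F assume F: "F \<in> {F. F \<subseteq> {z. f z = 0} \<and> finite F}"
      let ?R = "{z\<in>F. Re z > 0}" and ?L = "{z\<in>F. Re z < 0}"
      \<comment> \<open>Zeros on the imaginary axis contribute 0; neither half-plane bound covers
        them.\<close>
      have "sum ?t F = sum ?t (?R \<union> ?L)"
        using F by (intro sum.mono_neutral_right) (auto simp: not_less antisym)
      also have "\<dots> = sum ?t ?R + sum ?t ?L"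
        using F by (intro sum.union_disjoint) auto
      also have "\<dots> \<le> B1 + B2"
        using F by (intro add_mono right left) auto
      finally show "sum ?t F \<le> B1 + B2" .
    qed
  qed
qed

section \<open>Closure properties of the growth class\<close>

lemma tame_const: "tame (\<lambda>z. c)"
proof -
  have "cmod c \<le> exp (cmod c * (1 + \<bar>Re z\<bar> + sqrt (cmod z)))" for z
  proof -
    have "cmod c * 1 \<le> cmod c * (1 + \<bar>Re z\<bar> + sqrt (cmod z))"
      by (intro mult_left_mono) auto
    also have "\<dots> \<le> exp (cmod c * (1 + \<bar>Re z\<bar> + sqrt (cmod z)))"
      using exp_ge_add_one_self[of "cmod c * (1 + \<bar>Re z\<bar> + sqrt (cmod z))"] by linarith
    finally show ?thesis by simp
  qed
  then show ?thesis unfolding tame_def by blast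
qed

text \<open>Hides polynomial growth in the square-root term of \<open>tame\<close>: 1 + r \<le> (1 +
  sqrt r)^2, and 1 + t \<le> exp t.\<close>

lemma one_plus_le_exp_sqrt:
  assumes "r \<ge> 0"
  shows "1 + r \<le> exp (2 * sqrt r)"
proof -
  have "1 + r \<le> (1 + sqrt r)\<^sup>2"
    using assms by (simp add: power2_sum)
  also have "\<dots> \<le> (exp (sqrt r))\<^sup>2"
    using assms by (intro power_mono) auto
  also have "\<dots> = exp (2 * sqrt r)"
    by (simp add: power2_eq_square flip: exp_add)
  finally show ?thesis .
qed

lemma tame_ident: "tame (\<lambda>z. z)"
proof -
  have "cmod z \<le> exp (2 * (1 + \<bar>Re z\<bar> + sqrt (cmod z)))" for z
  proof -
    have "1 + cmod z \<le> exp (2 * sqrt (cmod z))"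
      by (rule one_plus_le_exp_sqrt) simp
    also have "\<dots> \<le> exp (2 * (1 + \<bar>Re z\<bar> + sqrt (cmod z)))"
      by simp
    finally show ?thesis by simp
  qed
  then show ?thesis unfolding tame_def by blast
qed

lemma tame_mult:
  assumes "tame f" "tame g"
  shows "tame (\<lambda>z. f z * g z)"
proof -
  obtain C where C: "\<And>z. cmod (f z) \<le> exp (C * (1 + \<bar>Re z\<bar> + sqrt (cmod z)))"
    using assms(1) unfolding tame_def by blast
  obtain D where D: "\<And>z. cmod (g z) \<le> exp (D * (1 + \<bar>Re z\<bar> + sqrt (cmod z)))"
    using assms(2) unfolding tame_def by blast
  have "cmod (f z * g z) \<le> exp ((C + D) * (1 + \<bar>Re z\<bar> + sqrt (cmod z)))" for z
    unfolding norm_mult distrib_right exp_add by (intro mult_mono C D) auto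
  then show ?thesis unfolding tame_def by blast
qed

lemma tame_add:
  assumes "tame f" "tame g"
  shows "tame (\<lambda>z. f z + g z)"
proof -
  obtain C where C: "C \<ge> 0" "\<And>z. cmod (f z) \<le> exp (C * (1 + \<bar>Re z\<bar> + sqrt (cmod z)))"
    using tame_bound_nonneg[OF assms(1)] by blast
  obtain D where D: "D \<ge> 0" "\<And>z. cmod (g z) \<le> exp (D * (1 + \<bar>Re z\<bar> + sqrt (cmod z)))"
    using tame_bound_nonneg[OF assms(2)] by blast
  have "cmod (f z + g z) \<le> exp ((1 + C + D) * (1 + \<bar>Re z\<bar> + sqrt (cmod z)))" for z
  proof -
    define L where "L = 1 + \<bar>Re z\<bar> + sqrt (cmod z)"
    have L: "1 \<le> L" by (simp add: L_def)
    then have le: "0 \<le> C * L" "0 \<le> D * L"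
      using C D by auto
    have "cmod (f z + g z) \<le> exp (C * L) + exp (D * L)"
      unfolding L_def by (intro norm_triangle_le add_mono C D)
    also have "\<dots> \<le> exp (C * L + D * L) + exp (C * L + D * L)"
      using le by (intro add_mono) auto
    also have "\<dots> = 2 * exp (C * L + D * L)" by simp
    \<comment> \<open>The summand 1 in the exponent of \<open>tame\<close> ensures L \<ge> 1, so
      enlarging the constant by 1 pays for the factor 2.\<close>
    also have "2 \<le> exp L"
      using exp_ge_add_one_self[of L] L by linarith
    then have "2 * exp (C * L + D * L) \<le> exp L * exp (C * L + D * L)"
      by (intro mult_right_mono) auto
    also have "\<dots> = exp ((1 + C + D) * L)"
      by (simp add: algebra_simps flip: exp_add)
    finally show ?thesis unfolding L_def .
  qed
  then show ?thesis unfolding tame_def by blast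
qed

lemma tame_uminus: "tame f \<Longrightarrow> tame (\<lambda>z. - f z)"
  using tame_mult[OF tame_const[of "-1"]] by simp

lemma tame_diff: "tame f \<Longrightarrow> tame g \<Longrightarrow> tame (\<lambda>z. f z - g z)"
  using tame_add[OF _ tame_uminus, of f g] by simp

lemma tame_power: "tame f \<Longrightarrow> tame (\<lambda>z. f z ^ n)"
  by (induction n) (auto intro: tame_const tame_mult)

lemmas tame_intros = tame_const tame_ident tame_add tame_diff tame_uminus tame_mult tame_power

section \<open>Linear systems with an affine parameter\<close>

lemma has_vector_derivative_series:
  fixes f :: "nat \<Rightarrow> real \<Rightarrow> 'a::banach"
  assumes "convex S"
    and f: "\<And>n x. x \<in> S \<Longrightarrow> (f n has_vector_derivative f' n x) (at x within S)"
    and lim: "uniform_limit S (\<lambda>n x. \<Sum>i<n. f' i x) g' sequentially"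
    and "x0 \<in> S" "summable (\<lambda>n. f n x0)"
  shows "\<exists>g. \<forall>x\<in>S. (\<lambda>n. f n x) sums g x \<and> (g has_vector_derivative g' x) (at x within S)"
  unfolding has_vector_derivative_def
proof (rule has_derivative_series)
  show "(f n has_derivative (\<lambda>h. h *\<^sub>R f' n x)) (at x within S)" if "x \<in> S" for n x
    using f[OF that] unfolding has_vector_derivative_def .
  show "\<forall>\<^sub>F n in sequentially. \<forall>x\<in>S. \<forall>h. norm ((\<Sum>i<n. h *\<^sub>R f' i x) - h *\<^sub>R g' x) \<le> e * norm h"
    if "e > 0" for e
    using uniform_limitD[OF lim that]
  proof eventually_elim
    case (elim n)
    show ?case
    proof (intro ballI allI)
      fix x and h :: real
      assume "x \<in> S"
      then have "norm ((\<Sum>i<n. f' i x) - g' x) \<le> e"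
        using elim by (simp add: dist_norm less_imp_le)
      moreover have "(\<Sum>i<n. h *\<^sub>R f' i x) - h *\<^sub>R g' x = h *\<^sub>R ((\<Sum>i<n. f' i x) - g' x)"
        by (simp add: scaleR_sum_right scaleR_diff_right)
      ultimately show "norm ((\<Sum>i<n. h *\<^sub>R f' i x) - h *\<^sub>R g' x) \<le> e * norm h"
        by (simp add: mult.commute[of e] mult_left_mono)
    qed
  qed
  show "(\<lambda>n. f n x0) sums (\<Sum>n. f n x0)"
    using assms by (simp add: summable_sums)
qed (use assms in auto)

text \<open>Contains the Picard iterates of a system that is affine in the parameter. Being polynomial in the
  parameter, they are holomorphic without differentiation under the integral sign.\<close>

inductive poly_family :: "real set \<Rightarrow> (complex \<Rightarrow> real \<Rightarrow> complex) \<Rightarrow> bool" for S where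
  monom: "continuous_on S c \<Longrightarrow> poly_family S (\<lambda>\<xi> s. c s * \<xi> ^ k)"
| add: "poly_family S f \<Longrightarrow> poly_family S g \<Longrightarrow> poly_family S (\<lambda>\<xi> s. f \<xi> s + g \<xi> s)"
| cong: "poly_family S f \<Longrightarrow> (\<And>\<xi> s. s \<in> S \<Longrightarrow> f \<xi> s = g \<xi> s) \<Longrightarrow> poly_family S g"

lemma poly_family_const: "poly_family S (\<lambda>\<xi> s. c)"
  using poly_family.monom[of S "\<lambda>_. c" 0] by simp

lemma poly_family_sum:
  "finite J \<Longrightarrow> (\<And>j. j \<in> J \<Longrightarrow> poly_family S (f j)) \<Longrightarrow> poly_family S (\<lambda>\<xi> s. \<Sum>j\<in>J. f j \<xi> s)"
  by (induction J rule: finite_induct) (auto intro: poly_family_const poly_family.add)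

lemma poly_family_cmult:
  assumes "poly_family S f" "continuous_on S c"
  shows "poly_family S (\<lambda>\<xi> s. c s * f \<xi> s)"
  using assms(1)
proof induction
  case (monom d k)
  have "poly_family S (\<lambda>\<xi> s. (c s * d s) * \<xi> ^ k)"
    by (intro poly_family.monom continuous_intros monom assms)
  then show ?case by (simp add: mult.assoc)
next
  case (add f g)
  then show ?case using poly_family.add by (fastforce simp: distrib_left)
next
  case (cong f g)
  show ?case by (rule poly_family.cong[OF cong.IH]) (simp add: cong)
qed

lemma poly_family_param_mult:
  assumes "poly_family S f"
  shows "poly_family S (\<lambda>\<xi> s. \<xi> * f \<xi> s)"
  using assms
proof induction
  case (monom d k)
  have "poly_family S (\<lambda>\<xi> s. d s * \<xi> ^ Suc k)"
    by (intro poly_family.monom monom)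
  then show ?case by (simp add: mult_ac)
next
  case (add f g)
  then show ?case using poly_family.add by (fastforce simp: distrib_left)
next
  case (cong f g)
  show ?case by (rule poly_family.cong[OF cong.IH]) (simp add: cong)
qed

lemma poly_family_continuous: "poly_family S f \<Longrightarrow> continuous_on S (f \<xi>)"
proof (induction rule: poly_family.induct)
  case (cong f g)
  then show ?case using continuous_on_cong[of S S "f \<xi>" "g \<xi>"] by simp
qed (auto intro!: continuous_intros)

lemma poly_family_holomorphic: "poly_family S f \<Longrightarrow> s \<in> S \<Longrightarrow> (\<lambda>\<xi>. f \<xi> s) holomorphic_on UNIV"
  by (induction rule: poly_family.induct) (auto intro!: holomorphic_intros)

text \<open>On a monomial the power of the parameter simply leaves the integral. Sums need
  additivity of the integral, hence integrability, which is known only for \<open>s\<close> in the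
  interval; this is where the rule \<open>cong\<close> is called for.\<close>

lemma poly_family_integral:
  assumes "poly_family {a..b} f"
  shows "poly_family {a..b} (\<lambda>\<xi> s. integral {a..s} (f \<xi>))"
  using assms
proof induction
  case (monom d k)
  have "continuous_on {a..b} (\<lambda>s. integral {a..s} d)"
    by (intro indefinite_integral_continuous_1 integrable_continuous_real monom)
  then show ?case
    using poly_family.monom[of "{a..b}" "\<lambda>s. integral {a..s} d" k] by simp
next
  case (add f g)
  show ?case
  proof (rule poly_family.cong[OF poly_family.add[OF add.IH]])
    fix \<xi> s assume "s \<in> {a..b}"
    then have "f \<xi> integrable_on {a..s}" "g \<xi> integrable_on {a..s}"
      using add.hyps[THEN poly_family_continuous[where \<xi> = \<xi>]]
      by (auto intro!: integrable_continuous_real intro: continuous_on_subset)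
    then show "integral {a..s} (f \<xi>) + integral {a..s} (g \<xi>) = integral {a..s} (\<lambda>t. f \<xi> t + g \<xi> t)"
      by (simp add: integral_add)
  qed
next
  case (cong f g)
  show ?case
    by (rule poly_family.cong[OF cong.IH], rule integral_cong) (use cong in auto)
qed

text \<open>The n-th term is the difference of two successive Picard iterates, so the solution is
  the sum of all terms (the Peano-Baker series).\<close>

primrec picard_term ::
    "('i \<Rightarrow> 'i \<Rightarrow> real \<Rightarrow> complex) \<Rightarrow> ('i \<Rightarrow> complex) \<Rightarrow> real \<Rightarrow> nat \<Rightarrow> 'i::finite \<Rightarrow> real \<Rightarrow> complex" where
  "picard_term A v a 0 i s = v i"
| "picard_term A v a (Suc n) i s = integral {a..s} (\<lambda>t. \<Sum>j\<in>UNIV. A i j t * picard_term A v a n j t)"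

lemma picard_term_continuous:
  assumes "\<And>i j. continuous_on {a..b} (A i j)"
  shows "continuous_on {a..b} (picard_term A v a n i)"
proof (induction n arbitrary: i)
  case (Suc n)
  have "continuous_on {a..b} (\<lambda>t. \<Sum>j\<in>UNIV. A i j t * picard_term A v a n j t)"
    by (intro continuous_intros assms Suc)
  then show ?case
    by (simp add: indefinite_integral_continuous_1 integrable_continuous_real)
qed (simp add: continuous_on_const)

lemma picard_term_deriv:
  assumes "\<And>i j. continuous_on {a..b} (A i j)" "s \<in> {a..b}"
  shows "(picard_term A v a (Suc n) i has_vector_derivative
    (\<Sum>j\<in>UNIV. A i j s * picard_term A v a n j s)) (at s within {a..b})"
proof -
  have "picard_term A v a (Suc n) i
      = (\<lambda>s. integral {a..s} (\<lambda>t. \<Sum>j\<in>UNIV. A i j t * picard_term A v a n j t))"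
    by auto
  then show ?thesis
    using assms by (simp only:) (intro integral_has_vector_derivative continuous_intros picard_term_continuous)
qed

lemma picard_term_poly_family:
  assumes "\<And>i j. continuous_on {a..b} (P i j)" "\<And>i j. continuous_on {a..b} (Q i j)"
  shows "poly_family {a..b} (\<lambda>\<xi>. picard_term (\<lambda>i j t. P i j t + \<xi> * Q i j t) v a n i)"
proof (induction n arbitrary: i)
  case 0
  then show ?case using poly_family_const by simp
next
  case (Suc n)
  let ?p = "\<lambda>\<xi>. picard_term (\<lambda>i j t. P i j t + \<xi> * Q i j t) v a n"
  have "poly_family {a..b} (\<lambda>\<xi> t. P i j t * ?p \<xi> j t + \<xi> * (Q i j t * ?p \<xi> j t))" for j
    by (intro poly_family.add poly_family_param_mult poly_family_cmult assms Suc)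
  then have "poly_family {a..b} (\<lambda>\<xi> t. \<Sum>j\<in>UNIV. P i j t * ?p \<xi> j t + \<xi> * (Q i j t * ?p \<xi> j t))"
    by (intro poly_family_sum) auto
  from poly_family_integral[OF this] show ?case
    by (simp add: algebra_simps)
qed

lemma picard_term_bound:
  assumes cont: "\<And>i j. continuous_on {a..b} (A i j)"
    and K: "\<And>i j t. t \<in> {a..b} \<Longrightarrow> cmod (A i j t) \<le> K"
    and V: "\<And>i. cmod (v i) \<le> V" and "s \<in> {a..b}"
  shows "cmod (picard_term A v a n (i::'i::finite) s) \<le> V * (real CARD('i) * K * (s - a)) ^ n / fact n"
  using \<open>s \<in> {a..b}\<close>
proof (induction n arbitrary: i s)
  case 0
  then show ?case using V by simp
next
  case (Suc n)
  define c where "c = real CARD('i) * K"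
  \<comment> \<open>\<open>g\<close> is the induction hypothesis times the bound \<open>c\<close>
    for the row sums of \<open>A\<close>. \<open>G\<close> is its primitive with
    \<open>G a = 0\<close>; integrating the power produces the next factorial.\<close>
  define G where "G t = V * c ^ Suc n / fact (Suc n) * (t - a) ^ Suc n" for t
  define g where "g t = c * (V * (c * (t - a)) ^ n / fact n)" for t
  let ?f = "\<lambda>t. \<Sum>j\<in>UNIV. A i j t * picard_term A v a n j t"
  have "(G has_real_derivative g t) (at t within {a..s})" for t
  proof -
    have "((\<lambda>t. (t - a) ^ Suc n) has_real_derivative real (Suc n) * (t - a) ^ n) (at t within {a..s})"
      by (rule derivative_eq_intros refl | simp)+
    then have "(G has_real_derivative V * c ^ Suc n / fact (Suc n) * (real (Suc n) * (t - a) ^ n)) (at t within {a..s})"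
      unfolding G_def by (rule DERIV_cmult)
    also have "V * c ^ Suc n / fact (Suc n) * (real (Suc n) * (t - a) ^ n) = g t"
      by (simp add: g_def power_mult_distrib del: of_nat_Suc)
    finally show ?thesis .
  qed
  then have "(g has_integral G s - G a) {a..s}"
    using Suc.prems by (intro fundamental_theorem_of_calculus)
      (auto simp: has_real_derivative_iff_has_vector_derivative)
  then have g: "(g has_integral G s) {a..s}"
    by (simp add: G_def)
  have "continuous_on {a..b} ?f"
    by (intro continuous_intros cont picard_term_continuous)
  then have "?f integrable_on {a..s}"
    using Suc.prems by (intro integrable_continuous_real) (auto intro: continuous_on_subset)
  moreover have "cmod (?f t) \<le> g t" if "t \<in> {a..s}" for t
  proof -
    have t: "t \<in> {a..b}" using that Suc.prems by auto
    have "0 \<le> K" using K[OF t] norm_ge_zero order_trans by blast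
    have "cmod (?f t) \<le> (\<Sum>j\<in>(UNIV::'i set). K * (V * (c * (t - a)) ^ n / fact n))"
      unfolding c_def by (intro sum_norm_le) (unfold norm_mult, intro mult_mono K Suc.IH t \<open>0 \<le> K\<close> norm_ge_zero)
    then show ?thesis
      by (simp add: g_def c_def)
  qed
  ultimately have "cmod (integral {a..s} ?f) \<le> integral {a..s} g"
    using g by (intro integral_norm_bound_integral) auto
  also have "integral {a..s} g = G s"
    using g by blast
  finally show ?case
    unfolding G_def c_def by (simp add: power_mult_distrib mult_ac)
qed

section \<open>Convergence of the Picard series and holomorphy in the parameter\<close>

lemma continuous_matrix_bounded:
  fixes A :: "'i::finite \<Rightarrow> 'j::finite \<Rightarrow> real \<Rightarrow> complex"
  assumes cont: "\<And>i j. continuous_on {a..b} (A i j)"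
  shows "\<exists>K\<ge>0. \<forall>i j. \<forall>t\<in>{a..b}. cmod (A i j t) \<le> K"
proof -
  have "bounded (A i j ` {a..b})" for i j
    by (intro compact_imp_bounded compact_continuous_image cont compact_Icc)
  then have "bounded (\<Union>i. \<Union>j. A i j ` {a..b})"
    by (intro bounded_UN) auto
  then obtain K where "0 < K" "\<forall>z\<in>(\<Union>i. \<Union>j. A i j ` {a..b}). cmod z \<le> K"
    unfolding bounded_pos by blast
  then show ?thesis by (intro exI[of _ K]) auto
qed

text \<open>Replacing s - a by b - a makes the bound uniform on the interval, as the Weierstrass
  test demands.\<close>

lemma picard_term_majorant:
  assumes cont: "\<And>i j. continuous_on {a..b} (A i j)"
    and K: "\<And>i j t. t \<in> {a..b} \<Longrightarrow> cmod (A i j t) \<le> K" and s: "s \<in> {a..b}"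
  shows "cmod (picard_term A v a n (i::'i::finite) s)
    \<le> (\<Sum>i\<in>UNIV. cmod (v i)) * (real CARD('i) * K * (b - a)) ^ n / fact n"
proof -
  have "0 \<le> K" using K[OF s] norm_ge_zero order_trans by blast
  have V: "cmod (v i) \<le> (\<Sum>i\<in>UNIV. cmod (v i))" for i
    by (rule member_le_sum) auto
  have "cmod (picard_term A v a n i s)
      \<le> (\<Sum>i\<in>UNIV. cmod (v i)) * (real CARD('i) * K * (s - a)) ^ n / fact n"
    by (rule picard_term_bound[OF cont K V s])
  also have "\<dots> \<le> (\<Sum>i\<in>UNIV. cmod (v i)) * (real CARD('i) * K * (b - a)) ^ n / fact n"
    using s \<open>0 \<le> K\<close> by (intro divide_right_mono mult_left_mono power_mono) (auto intro: sum_nonneg)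
  finally show ?thesis .
qed

lemma picard_majorant_summable: "summable (\<lambda>n. V * c ^ n / fact n :: real)"
  using summable_mult[OF summable_exp[of c], of V] by (simp add: field_simps)

lemma picard_series:
  fixes A :: "'i::finite \<Rightarrow> 'i \<Rightarrow> real \<Rightarrow> complex" and v :: "'i \<Rightarrow> complex"
  assumes "a \<le> b" and cont: "\<And>i j. continuous_on {a..b} (A i j)"
  defines "y \<equiv> \<lambda>i s. \<Sum>n. picard_term A v a n i s"
  shows "s \<in> {a..b} \<Longrightarrow> (y i has_vector_derivative (\<Sum>j\<in>UNIV. A i j s * y j s)) (at s within {a..b})"
    and "y i a = v i"
proof -
  obtain K where "0 \<le> K" and K: "\<And>i j t. t \<in> {a..b} \<Longrightarrow> cmod (A i j t) \<le> K"
    using continuous_matrix_bounded[of a b A, OF cont] by auto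
  define M where "M n = (\<Sum>i\<in>UNIV. cmod (v i)) * (real CARD('i) * K * (b - a)) ^ n / fact n" for n
  have bound: "cmod (picard_term A v a n i s) \<le> M n" if "s \<in> {a..b}" for n i s
    unfolding M_def by (rule picard_term_majorant[OF cont K that])
  have M: "summable M"
    unfolding M_def by (rule picard_majorant_summable)
  have summ: "summable (\<lambda>n. picard_term A v a n i s)" if "s \<in> {a..b}" for i s
    by (rule summable_comparison_test'[OF M]) (rule bound[OF that])
  show "y i a = v i"
  proof -
    have "(\<lambda>n. picard_term A v a n i a) = (\<lambda>n. if n = 0 then v i else 0)"
    proof
      show "picard_term A v a n i a = (if n = 0 then v i else 0)" for n by (cases n) auto
    qed
    then show ?thesis
      using sums_single[of 0 "\<lambda>_. v i"] by (simp add: y_def sums_unique[symmetric])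
  qed
  \<comment> \<open>Derivatives of the terms: differentiation lowers the index by one, and the
    constant term of index 0 contributes 0.\<close>
  define d where "d n s = (case n of 0 \<Rightarrow> 0 | Suc m \<Rightarrow> \<Sum>j\<in>UNIV. A i j s * picard_term A v a m j s)" for n s
  have "uniform_limit {a..b} (\<lambda>n s. \<Sum>k<n. d k s) (\<lambda>s. \<Sum>k. d k s) sequentially"
  proof (rule Weierstrass_m_test)
    show "cmod (d n s) \<le> (case n of 0 \<Rightarrow> 0 | Suc m \<Rightarrow> real CARD('i) * K * M m)" if "s \<in> {a..b}" for n s
    proof (cases n)
      case (Suc m)
      have "cmod (\<Sum>j\<in>UNIV. A i j s * picard_term A v a m j s) \<le> (\<Sum>j\<in>(UNIV::'i set). K * M m)"
        by (intro sum_norm_le) (unfold norm_mult, intro mult_mono K bound that \<open>0 \<le> K\<close> norm_ge_zero)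
      then show ?thesis by (simp add: d_def Suc)
    qed (simp add: d_def)
    have "summable (\<lambda>n. case Suc n of 0 \<Rightarrow> 0 | Suc m \<Rightarrow> real CARD('i) * K * M m)"
      using M by (simp add: summable_mult)
    then show "summable (\<lambda>n. case n of 0 \<Rightarrow> 0 | Suc m \<Rightarrow> real CARD('i) * K * M m)"
      by (subst (asm) summable_Suc_iff)
  qed
  then have "\<exists>g. \<forall>x\<in>{a..b}. (\<lambda>n. picard_term A v a n i x) sums g x \<and>
      (g has_vector_derivative (\<Sum>k. d k x)) (at x within {a..b})"
  proof (rule has_vector_derivative_series[rotated 2])
    show "(picard_term A v a n i has_vector_derivative d n x) (at x within {a..b})" if "x \<in> {a..b}" for n x
    proof (cases n)
      case 0
      have "picard_term A v a 0 i = (\<lambda>_. v i)" by auto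
      then show ?thesis using 0 by (simp add: d_def)
    next
      case (Suc m)
      then show ?thesis using picard_term_deriv[OF cont that] by (simp only: d_def nat.case)
    qed
    show "summable (\<lambda>n. picard_term A v a n i a)" using summ \<open>a \<le> b\<close> by auto
  qed (use \<open>a \<le> b\<close> in auto)
  then obtain g where g: "\<And>x. x \<in> {a..b} \<Longrightarrow> (\<lambda>n. picard_term A v a n i x) sums g x"
    "\<And>x. x \<in> {a..b} \<Longrightarrow> (g has_vector_derivative (\<Sum>k. d k x)) (at x within {a..b})"
    by blast
  assume s: "s \<in> {a..b}"
  have "(\<Sum>k. d k s) = (\<Sum>k. d (Suc k) s)"
  proof -
    have "(\<lambda>k. d (Suc k) s) sums (\<Sum>j\<in>UNIV. A i j s * y j s)"
      unfolding d_def nat.case y_def by (intro sums_sum sums_mult summable_sums summ s)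
    then have "(\<lambda>k. d k s) sums ((\<Sum>j\<in>UNIV. A i j s * y j s) + d 0 s)"
      by (subst (asm) sums_Suc_iff) simp
    then show ?thesis using \<open>(\<lambda>k. d (Suc k) s) sums _\<close> by (simp add: sums_unique[symmetric] d_def)
  qed
  also have "\<dots> = (\<Sum>j\<in>UNIV. A i j s * y j s)"
    unfolding d_def nat.case y_def
    by (intro sums_unique[symmetric] sums_sum sums_mult summable_sums summ s)
  finally have "(g has_vector_derivative (\<Sum>j\<in>UNIV. A i j s * y j s)) (at s within {a..b})"
    using g(2)[OF s] by simp
  then show "(y i has_vector_derivative (\<Sum>j\<in>UNIV. A i j s * y j s)) (at s within {a..b})"
    by (rule has_vector_derivative_transform[OF s, rotated]) (use g(1) in \<open>auto simp: y_def intro: sums_unique[symmetric]\<close>)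
qed

lemma picard_series_holomorphic:
  fixes P Q :: "'i::finite \<Rightarrow> 'i \<Rightarrow> real \<Rightarrow> complex"
  assumes "\<And>i j. continuous_on {a..b} (P i j)" "\<And>i j. continuous_on {a..b} (Q i j)" and s: "s \<in> {a..b}"
  shows "(\<lambda>\<xi>. \<Sum>n. picard_term (\<lambda>i j t. P i j t + \<xi> * Q i j t) v a n i s) holomorphic_on UNIV"
    (is "(\<lambda>\<xi>. \<Sum>n. ?p \<xi> n i) holomorphic_on UNIV")
proof (rule holomorphic_uniform_sequence[OF open_UNIV])
  show "(\<lambda>\<xi>. \<Sum>k<n. ?p \<xi> k i) holomorphic_on UNIV" for n
    by (intro holomorphic_intros poly_family_holomorphic[OF picard_term_poly_family[OF assms(1,2)] s])
  fix \<xi>0 :: complex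
  obtain KP where KP: "0 \<le> KP" "\<And>i j t. t \<in> {a..b} \<Longrightarrow> cmod (P i j t) \<le> KP"
    using continuous_matrix_bounded[of a b P, OF assms(1)] by auto
  obtain KQ where KQ: "0 \<le> KQ" "\<And>i j t. t \<in> {a..b} \<Longrightarrow> cmod (Q i j t) \<le> KQ"
    using continuous_matrix_bounded[of a b Q, OF assms(2)] by auto
  \<comment> \<open>Bounds all coefficients for every \<xi> in the closed unit disc about
    \<open>\<xi>0\<close>, so that one majorant serves the whole disc and the convergence is locally
    uniform.\<close>
  define K where "K = KP + (cmod \<xi>0 + 1) * KQ"
  have K: "cmod (P i j t + \<xi> * Q i j t) \<le> K" if "t \<in> {a..b}" "\<xi> \<in> cball \<xi>0 1" for i j t \<xi>
  proof -
    have "cmod \<xi> \<le> cmod \<xi>0 + 1"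
      using that(2) norm_triangle_sub[of \<xi> \<xi>0] by (simp add: dist_norm norm_minus_commute)
    then have "cmod (\<xi> * Q i j t) \<le> (cmod \<xi>0 + 1) * KQ"
      unfolding norm_mult using KQ that by (intro mult_mono) auto
    then show ?thesis
      unfolding K_def using KP(2)[OF that(1)] by (intro norm_triangle_le add_mono)
  qed
  have "uniform_limit (cball \<xi>0 1) (\<lambda>n \<xi>. \<Sum>k<n. ?p \<xi> k i) (\<lambda>\<xi>. \<Sum>k. ?p \<xi> k i) sequentially"
  proof (rule Weierstrass_m_test)
    show "cmod (?p \<xi> n i)
        \<le> (\<Sum>i\<in>UNIV. cmod (v i)) * (real CARD('i) * K * (b - a)) ^ n / fact n"
      if "\<xi> \<in> cball \<xi>0 1" for n \<xi>
      by (rule picard_term_majorant[OF _ _ s]) (intro continuous_intros assms K that)+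
  qed (rule picard_majorant_summable)
  then show "\<exists>d>0. cball \<xi>0 d \<subseteq> UNIV \<and>
      uniform_limit (cball \<xi>0 d) (\<lambda>n \<xi>. \<Sum>k<n. ?p \<xi> k i) (\<lambda>\<xi>. \<Sum>k. ?p \<xi> k i) sequentially"
    by (intro exI[of _ 1]) auto
qed

text \<open>The initial vector is the same for all parameter values. Data that vary with the
  parameter, such as those of the Jost solutions, are expanded later in the basis obtained from the
  unit vectors.\<close>

theorem linear_ode_entire:
  fixes P Q :: "'i::finite \<Rightarrow> 'i \<Rightarrow> real \<Rightarrow> complex"
  assumes "a \<le> b" "\<And>i j. continuous_on {a..b} (P i j)" "\<And>i j. continuous_on {a..b} (Q i j)"
  obtains y where "\<And>\<xi> i. y \<xi> i a = v i"
    "\<And>\<xi> i s. s \<in> {a..b} \<Longrightarrow> (y \<xi> i has_vector_derivative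
        (\<Sum>j\<in>UNIV. (P i j s + \<xi> * Q i j s) * y \<xi> j s)) (at s within {a..b})"
    "\<And>i s. s \<in> {a..b} \<Longrightarrow> (\<lambda>\<xi>. y \<xi> i s) holomorphic_on UNIV"
proof -
  have cont: "continuous_on {a..b} (\<lambda>t. P i j t + \<xi> * Q i j t)" for \<xi> i j
    by (intro continuous_intros assms)
  show thesis
  proof (rule that[of "\<lambda>\<xi> i s. \<Sum>n. picard_term (\<lambda>i j t. P i j t + \<xi> * Q i j t) v a n i s"])
    fix \<xi> i
    show "(\<Sum>n. picard_term (\<lambda>i j t. P i j t + \<xi> * Q i j t) v a n i a) = v i"
      by (rule picard_series(2)[OF assms(1) cont])
  next
    fix \<xi> i s assume "s \<in> {a..b}"
    then show "((\<lambda>s. \<Sum>n. picard_term (\<lambda>i j t. P i j t + \<xi> * Q i j t) v a n i s) has_vector_derivative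
      (\<Sum>j\<in>UNIV. (P i j s + \<xi> * Q i j s) * (\<Sum>n. picard_term (\<lambda>i j t. P i j t + \<xi> * Q i j t) v a n j s)))
      (at s within {a..b})"
      by (rule picard_series(1)[OF assms(1) cont])
  next
    fix i s assume "s \<in> {a..b}"
    then show "(\<lambda>\<xi>. \<Sum>n. picard_term (\<lambda>i j t. P i j t + \<xi> * Q i j t) v a n i s) holomorphic_on UNIV"
      by (rule picard_series_holomorphic[OF assms(2,3)])
  qed
qed

section \<open>The Rayleigh system as a first-order system\<close>

text \<open>The swap matrix is Hermitian, so the imaginary part of \<open>z\<close> turns it into a
  skew-Hermitian matrix, which drops out of the real inner product. This is the source of |Re \<xi>|
  in place of |\<xi>|.\<close>

lemma inner_swap_le: "u \<bullet> (z * v) + v \<bullet> (z * u) \<le> \<bar>Re z\<bar> * ((cmod u)\<^sup>2 + (cmod v)\<^sup>2)"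
  for u v z :: complex
proof -
  have "u \<bullet> (z * v) + v \<bullet> (z * u) = 2 * Re z * (u \<bullet> v)"
    by (simp add: inner_complex_def algebra_simps)
  also have "\<dots> \<le> \<bar>Re z\<bar> * (2 * (cmod u * cmod v))"
  proof -
    have "2 * Re z * (u \<bullet> v) \<le> 2 * \<bar>Re z\<bar> * \<bar>u \<bullet> v\<bar>"
      by (metis abs_ge_self abs_mult abs_numeral)
    also have "\<dots> \<le> 2 * \<bar>Re z\<bar> * (cmod u * cmod v)"
      by (intro mult_left_mono Cauchy_Schwarz_ineq2) auto
    finally show ?thesis by (simp add: mult_ac)
  qed
  also have "\<dots> \<le> \<bar>Re z\<bar> * ((cmod u)\<^sup>2 + (cmod v)\<^sup>2)"
    using sum_squares_bound[of "cmod u" "cmod v"] by (intro mult_left_mono) (auto simp: mult.assoc)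
  finally show ?thesis .
qed

lemma inner_scaled_le: "u \<bullet> (z * v) \<le> C * (cmod u * cmod v)" if "cmod z \<le> C" for u v z :: complex
proof -
  have "u \<bullet> (z * v) \<le> cmod u * (cmod z * cmod v)"
    using norm_cauchy_schwarz[of u "z * v"] by (simp add: norm_mult)
  also have "\<dots> \<le> cmod u * (C * cmod v)"
    using that by (intro mult_left_mono mult_right_mono) auto
  finally show ?thesis by (simp add: mult_ac)
qed

text \<open>The left-hand side is half the derivative of the energy. The swap terms give |Re \<xi>|.
  Every other term pairs one of \<open>y1\<close>, \<open>y2\<close> with one of \<open>y3\<close>,
  \<open>y4\<close> and has a coefficient of order m: in the first group through the weight, in the
  second because |\<xi>| \<le> m and 1 \<le> m. Since the energy controls sqrt m |y1|, such a
  product costs only sqrt m.\<close>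

lemma energy_algebra:
  fixes \<xi> y1 y2 y3 y4 :: complex and a b d w c :: real
  assumes "\<bar>a\<bar> \<le> c" "\<bar>b\<bar> \<le> c" "\<bar>d\<bar> \<le> c" "\<bar>w\<bar> \<le> c"
  defines "m \<equiv> 1 + cmod \<xi>"
  shows "m * (y1 \<bullet> (- \<xi> * y2 + a * y4) + y2 \<bullet> (- \<xi> * y1 + b * y3))
      + (y3 \<bullet> (\<xi> * y4 + 2 * complex_of_real d * \<xi> * y1 - complex_of_real w * y2) + y4 \<bullet> (\<xi> * y3 + 2 * complex_of_real d * \<xi> * y2 - complex_of_real w * y1))
    \<le> (\<bar>Re \<xi>\<bar> + 2 * c * sqrt m)
        * (m * ((cmod y1)\<^sup>2 + (cmod y2)\<^sup>2) + (cmod y3)\<^sup>2 + (cmod y4)\<^sup>2)"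
proof -
  define n1 where "n1 = cmod y1"
  define n2 where "n2 = cmod y2"
  define n3 where "n3 = cmod y3"
  define n4 where "n4 = cmod y4"
  note n_defs = n1_def n2_def n3_def n4_def
  have m: "1 \<le> m" by (simp add: m_def)
  have c: "0 \<le> c" using assms by linarith
  have nonneg: "0 \<le> n1" "0 \<le> n2" "0 \<le> n3" "0 \<le> n4" by (simp_all add: n_defs)
  have "m * (y1 \<bullet> (- \<xi> * y2 + a * y4) + y2 \<bullet> (- \<xi> * y1 + b * y3))
      \<le> m * (\<bar>Re \<xi>\<bar> * (n1\<^sup>2 + n2\<^sup>2) + c * (n1 * n4) + c * (n2 * n3))"
  proof (intro mult_left_mono)
    have "y1 \<bullet> (- \<xi> * y2) + y2 \<bullet> (- \<xi> * y1) \<le> \<bar>Re \<xi>\<bar> * (n1\<^sup>2 + n2\<^sup>2)"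
      using inner_swap_le[of y1 "- \<xi>" y2] by (simp add: n_defs)
    moreover have "y1 \<bullet> (a * y4) \<le> c * (n1 * n4)" "y2 \<bullet> (b * y3) \<le> c * (n2 * n3)"
      unfolding n_defs using assms by (intro inner_scaled_le; simp)+
    ultimately show "y1 \<bullet> (- \<xi> * y2 + a * y4) + y2 \<bullet> (- \<xi> * y1 + b * y3)
        \<le> \<bar>Re \<xi>\<bar> * (n1\<^sup>2 + n2\<^sup>2) + c * (n1 * n4) + c * (n2 * n3)"
      unfolding inner_add_right by linarith
  qed (use m in simp)
  moreover have "y3 \<bullet> (\<xi> * y4 + 2 * complex_of_real d * \<xi> * y1 - complex_of_real w * y2) + y4 \<bullet> (\<xi> * y3 + 2 * complex_of_real d * \<xi> * y2 - complex_of_real w * y1)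
      \<le> \<bar>Re \<xi>\<bar> * (n3\<^sup>2 + n4\<^sup>2) + c * m * (2 * n1 * n3 + 2 * n2 * n4 + n2 * n3 + n1 * n4)"
  proof -
    have "y3 \<bullet> (\<xi> * y4) + y4 \<bullet> (\<xi> * y3) \<le> \<bar>Re \<xi>\<bar> * (n3\<^sup>2 + n4\<^sup>2)"
      using inner_swap_le[of y3 "\<xi>" y4] by (simp add: n_defs)
    moreover have "cmod (2 * complex_of_real d * \<xi>) \<le> 2 * c * m"
    proof -
      have "\<bar>d\<bar> * cmod \<xi> \<le> c * m"
        using assms(3) m c by (intro mult_mono) (auto simp: m_def)
      then show ?thesis by (simp add: norm_mult)
    qed
    then have "y3 \<bullet> (2 * complex_of_real d * \<xi> * y1) \<le> 2 * c * m * (n3 * n1)" "y4 \<bullet> (2 * complex_of_real d * \<xi> * y2) \<le> 2 * c * m * (n4 * n2)"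
      unfolding n_defs by (intro inner_scaled_le; simp)+
    moreover have "cmod (- complex_of_real w) \<le> c * m"
      using mult_mono[OF assms(4) m] c by simp
    then have "y3 \<bullet> (- complex_of_real w * y2) \<le> c * m * (n3 * n2)" "y4 \<bullet> (- complex_of_real w * y1) \<le> c * m * (n4 * n1)"
      unfolding n_defs by (intro inner_scaled_le; simp)+
    ultimately show ?thesis
      unfolding inner_add_right inner_diff_right by (simp add: algebra_simps)
  qed
  \<comment> \<open>The cross terms of the two groups add up to exactly this product.\<close>
  moreover have "c * m * (2 * ((n1 + n2) * (n3 + n4)))
      \<le> 2 * c * sqrt m * (m * (n1\<^sup>2 + n2\<^sup>2) + n3\<^sup>2 + n4\<^sup>2)"
  proof -
    define r where "r = sqrt m"
    have r: "m = r * r" "0 \<le> r" using m by (simp_all add: r_def)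
    have "2 * ((r * (n1 + n2)) * (n3 + n4)) \<le> (r * (n1 + n2))\<^sup>2 + (n3 + n4)\<^sup>2"
      using sum_squares_bound[of "r * (n1 + n2)" "n3 + n4"] by (simp add: mult.assoc)
    also have "\<dots> \<le> m * (2 * (n1\<^sup>2 + n2\<^sup>2)) + 2 * (n3\<^sup>2 + n4\<^sup>2)"
    proof (intro add_mono)
      have sq: "(x + y)\<^sup>2 \<le> 2 * (x\<^sup>2 + y\<^sup>2)" for x y :: real
        using sum_squares_bound[of x y] by (simp add: power2_sum)
      have "m * (n1 + n2)\<^sup>2 \<le> m * (2 * (n1\<^sup>2 + n2\<^sup>2))"
        using m by (intro mult_left_mono sq) simp
      then show "(r * (n1 + n2))\<^sup>2 \<le> m * (2 * (n1\<^sup>2 + n2\<^sup>2))"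
        by (simp add: r(1) power2_eq_square mult_ac)
      show "(n3 + n4)\<^sup>2 \<le> 2 * (n3\<^sup>2 + n4\<^sup>2)" by (rule sq)
    qed
    finally have "c * r * (2 * ((r * (n1 + n2)) * (n3 + n4)))
        \<le> c * r * (m * (2 * (n1\<^sup>2 + n2\<^sup>2)) + 2 * (n3\<^sup>2 + n4\<^sup>2))"
      using c r by (intro mult_left_mono) auto
    then show ?thesis
      unfolding r_def[symmetric] by (simp add: r(1) algebra_simps)
  qed
  ultimately show ?thesis
    unfolding n_defs[symmetric] by (simp add: algebra_simps)
qed

lemma has_real_derivative_norm_square:
  fixes y :: "real \<Rightarrow> complex"
  assumes "(y has_vector_derivative d) (at s)"
  shows "((\<lambda>s. (cmod (y s))\<^sup>2) has_real_derivative 2 * (y s \<bullet> d)) (at s)"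
  unfolding power2_norm_eq_inner has_field_derivative_def
  by (rule has_derivative_eq_rhs[OF has_derivative_inner[OF assms[unfolded has_vector_derivative_def]
        assms[unfolded has_vector_derivative_def]]]) (auto simp: inner_commute)

section \<open>The medium, constant below -H, and growth of the energy\<close>

lemma at_within_Iic_neq_bot: "at Z within {..c} \<noteq> bot" if "Z \<le> c" for Z c :: real
proof -
  have "Z islimpt {Z - 1..Z}" by (simp add: islimpt_Icc)
  then have "Z islimpt {..c}" by (rule islimpt_subset) (use that in auto)
  then show ?thesis by (simp add: trivial_limit_within)
qed

text \<open>Meant for the endpoint -H, to the left of which \<open>mu\<close> is constant: the
  one-sided difference quotients already determine the derivative.\<close>

lemma derivative_of_constant_left:
  fixes f :: "real \<Rightarrow> real"
  assumes "Z \<le> c" and const: "\<And>s. s \<le> c \<Longrightarrow> f s = k"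
    and f: "(f has_real_derivative D) (at Z within S)" and "{..c} \<subseteq> S"
  shows "D = 0"
proof -
  have "((\<lambda>_. k) has_real_derivative D) (at Z within {..c})"
    using has_field_derivative_subset[OF f \<open>{..c} \<subseteq> S\<close>] const \<open>Z \<le> c\<close>
    by (subst has_field_derivative_cong_eventually[where g = f]) (auto simp: eventually_at_filter)
  moreover have "((\<lambda>_. k) has_real_derivative 0) (at Z within {..c})"
    by (rule DERIV_const)
  ultimately show ?thesis
    using vector_derivative_unique_within at_within_Iic_neq_bot[OF \<open>Z \<le> c\<close>]
    by (metis has_real_derivative_iff_has_vector_derivative)
qed

text \<open>The derivatives are parameters because they are taken within \<open>{..0}\<close>, hence
  one-sided at 0. Continuity of \<open>mu'\<close> is recorded since \<open>mu'\<close> becomes a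
  coefficient of the first-order system.\<close>

locale rayleigh_medium =
  fixes \<omega> H lam0 mu0 :: real and lam mu lam' mu' :: "real \<Rightarrow> real"
  assumes \<omega>_pos: "\<omega> > 0" and H_pos: "H > 0"
    and mu_pos: "Z \<le> 0 \<Longrightarrow> mu Z > 0" and sigma_pos: "Z \<le> 0 \<Longrightarrow> lam Z + 2 * mu Z > 0"
    and lam_deriv: "Z \<le> 0 \<Longrightarrow> (lam has_real_derivative lam' Z) (at Z within {..0})"
    and mu_deriv: "Z \<le> 0 \<Longrightarrow> (mu has_real_derivative mu' Z) (at Z within {..0})"
    and mu'_cont: "continuous_on {..0} mu'"
    and lam_const: "Z < - H \<Longrightarrow> lam Z = lam0" and mu_const: "Z < - H \<Longrightarrow> mu Z = mu0"
begin

lemma lam_cont: "continuous_on {..0} lam"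
  using lam_deriv by (meson DERIV_continuous_on atMost_iff)

lemma mu_cont: "continuous_on {..0} mu"
  using mu_deriv by (meson DERIV_continuous_on atMost_iff)

text \<open>The medium is constant for Z < -H, but the plane waves are prescribed for Z \<le> -H;
  continuity closes the gap.\<close>

lemma const_upto:
  assumes "continuous_on {..0} f" "\<And>Z. Z < - H \<Longrightarrow> f Z = k" "Z \<le> - H"
  shows "f Z = (k::real)"
proof -
  have "f ` closure {..<- H} \<subseteq> {k}"
    using H_pos assms
    by (intro image_closure_subset continuous_on_subset[OF assms(1)]) auto
  then show ?thesis using assms(3) by auto
qed

lemma lam_const_upto: "Z \<le> - H \<Longrightarrow> lam Z = lam0"
  by (rule const_upto[OF lam_cont lam_const])

lemma mu_const_upto: "Z \<le> - H \<Longrightarrow> mu Z = mu0"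
  by (rule const_upto[OF mu_cont mu_const])

lemma mu'_const_upto: "Z \<le> - H \<Longrightarrow> mu' Z = 0"
  using H_pos by (intro derivative_of_constant_left[OF _ mu_const_upto mu_deriv]) auto

text \<open>\<open>y1, y2, y3, y4\<close> stand for \<open>\<psi>\<^sub>1, \<psi>\<^sub>2, (\<lambda> + 2 \<mu>) (\<psi>\<^sub>2' + \<xi> \<psi>\<^sub>1), \<mu> (\<psi>\<^sub>1' + \<xi> \<psi>\<^sub>2)\<close>.\<close>

definition rayleigh_ode ::
    "complex \<Rightarrow> real set \<Rightarrow> (real \<Rightarrow> complex) \<Rightarrow> (real \<Rightarrow> complex) \<Rightarrow> (real \<Rightarrow> complex) \<Rightarrow> (real \<Rightarrow> complex) \<Rightarrow> bool" where
  "rayleigh_ode \<xi> S y1 y2 y3 y4 \<longleftrightarrow> (\<forall>s\<in>S.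
     (y1 has_vector_derivative - \<xi> * y2 s + of_real (1 / mu s) * y4 s) (at s within S) \<and>
     (y2 has_vector_derivative - \<xi> * y1 s + of_real (1 / (lam s + 2 * mu s)) * y3 s) (at s within S) \<and>
     (y3 has_vector_derivative \<xi> * y4 s + 2 * of_real (mu' s) * \<xi> * y1 s - of_real (\<omega>\<^sup>2) * y2 s) (at s within S) \<and>
     (y4 has_vector_derivative \<xi> * y3 s + 2 * of_real (mu' s) * \<xi> * y2 s - of_real (\<omega>\<^sup>2) * y1 s) (at s within S))"

lemma rayleigh_ode_subset:
  assumes ode: "rayleigh_ode \<xi> S y1 y2 y3 y4" and "T \<subseteq> S"
  shows "rayleigh_ode \<xi> T y1 y2 y3 y4"
  unfolding rayleigh_ode_def
proof
  fix s assume "s \<in> T"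
  then have "s \<in> S" using \<open>T \<subseteq> S\<close> by auto
  note d = ode[unfolded rayleigh_ode_def, rule_format, OF this]
  show "(y1 has_vector_derivative - \<xi> * y2 s + of_real (1 / mu s) * y4 s) (at s within T) \<and>
     (y2 has_vector_derivative - \<xi> * y1 s + of_real (1 / (lam s + 2 * mu s)) * y3 s) (at s within T) \<and>
     (y3 has_vector_derivative \<xi> * y4 s + 2 * of_real (mu' s) * \<xi> * y1 s - of_real (\<omega>\<^sup>2) * y2 s) (at s within T) \<and>
     (y4 has_vector_derivative \<xi> * y3 s + 2 * of_real (mu' s) * \<xi> * y2 s - of_real (\<omega>\<^sup>2) * y1 s) (at s within T)"
    using d by (intro conjI) (elim conjE, erule has_vector_derivative_within_subset[OF _ \<open>T \<subseteq> S\<close>])+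
qed

lemma rayleigh_ode_scale:
  assumes ode: "rayleigh_ode \<xi> S y1 y2 y3 y4"
  shows "rayleigh_ode \<xi> S (\<lambda>s. c * y1 s) (\<lambda>s. c * y2 s) (\<lambda>s. c * y3 s) (\<lambda>s. c * y4 s)"
  unfolding rayleigh_ode_def
proof (intro ballI conjI)
  fix s assume "s \<in> S"
  note d = ode[unfolded rayleigh_ode_def, rule_format, OF this, THEN conjunct1]
    ode[unfolded rayleigh_ode_def, rule_format, OF this, THEN conjunct2, THEN conjunct1]
    ode[unfolded rayleigh_ode_def, rule_format, OF this, THEN conjunct2, THEN conjunct2, THEN conjunct1]
    ode[unfolded rayleigh_ode_def, rule_format, OF this, THEN conjunct2, THEN conjunct2, THEN conjunct2]
  note d = d[THEN has_vector_derivative_mult_right[where a = c], THEN has_vector_derivative_eq_rhs]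
  show "((\<lambda>s. c * y1 s) has_vector_derivative - \<xi> * (c * y2 s) + of_real (1 / mu s) * (c * y4 s)) (at s within S)"
    by (rule d(1)) (simp add: algebra_simps)
  show "((\<lambda>s. c * y2 s) has_vector_derivative
      - \<xi> * (c * y1 s) + of_real (1 / (lam s + 2 * mu s)) * (c * y3 s)) (at s within S)"
    by (rule d(2)) (simp add: algebra_simps)
  show "((\<lambda>s. c * y3 s) has_vector_derivative
      \<xi> * (c * y4 s) + 2 * of_real (mu' s) * \<xi> * (c * y1 s) - of_real (\<omega>\<^sup>2) * (c * y2 s)) (at s within S)"
    by (rule d(3)) (simp add: algebra_simps)
  show "((\<lambda>s. c * y4 s) has_vector_derivative
      \<xi> * (c * y3 s) + 2 * of_real (mu' s) * \<xi> * (c * y2 s) - of_real (\<omega>\<^sup>2) * (c * y1 s)) (at s within S)"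
    by (rule d(4)) (simp add: algebra_simps)
qed

lemma rayleigh_ode_add:
  assumes y: "rayleigh_ode \<xi> S y1 y2 y3 y4" and z: "rayleigh_ode \<xi> S z1 z2 z3 z4"
  shows "rayleigh_ode \<xi> S (\<lambda>s. y1 s + z1 s) (\<lambda>s. y2 s + z2 s) (\<lambda>s. y3 s + z3 s) (\<lambda>s. y4 s + z4 s)"
  unfolding rayleigh_ode_def
proof (intro ballI conjI)
  fix s assume s: "s \<in> S"
  note dy = y[unfolded rayleigh_ode_def, rule_format, OF s]
  note dz = z[unfolded rayleigh_ode_def, rule_format, OF s]
  note add = has_vector_derivative_add[THEN has_vector_derivative_eq_rhs]
  show "((\<lambda>s. y1 s + z1 s) has_vector_derivative
      - \<xi> * (y2 s + z2 s) + of_real (1 / mu s) * (y4 s + z4 s)) (at s within S)"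
    by (rule add[OF dy[THEN conjunct1] dz[THEN conjunct1]]) (simp add: algebra_simps add_divide_distrib)
  show "((\<lambda>s. y2 s + z2 s) has_vector_derivative
      - \<xi> * (y1 s + z1 s) + of_real (1 / (lam s + 2 * mu s)) * (y3 s + z3 s)) (at s within S)"
    by (rule add[OF dy[THEN conjunct2, THEN conjunct1] dz[THEN conjunct2, THEN conjunct1]])
      (simp add: algebra_simps add_divide_distrib)
  show "((\<lambda>s. y3 s + z3 s) has_vector_derivative \<xi> * (y4 s + z4 s)
      + 2 * of_real (mu' s) * \<xi> * (y1 s + z1 s) - of_real (\<omega>\<^sup>2) * (y2 s + z2 s)) (at s within S)"
    by (rule add[OF dy[THEN conjunct2, THEN conjunct2, THEN conjunct1]
          dz[THEN conjunct2, THEN conjunct2, THEN conjunct1]]) (simp add: algebra_simps)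
  show "((\<lambda>s. y4 s + z4 s) has_vector_derivative \<xi> * (y3 s + z3 s)
      + 2 * of_real (mu' s) * \<xi> * (y2 s + z2 s) - of_real (\<omega>\<^sup>2) * (y1 s + z1 s)) (at s within S)"
    by (rule add[OF dy[THEN conjunct2, THEN conjunct2, THEN conjunct2]
          dz[THEN conjunct2, THEN conjunct2, THEN conjunct2]]) (simp add: algebra_simps)
qed

definition energy ::
    "complex \<Rightarrow> (real \<Rightarrow> complex) \<Rightarrow> (real \<Rightarrow> complex) \<Rightarrow> (real \<Rightarrow> complex) \<Rightarrow> (real \<Rightarrow> complex) \<Rightarrow> real \<Rightarrow> real" where
  "energy \<xi> y1 y2 y3 y4 s = (1 + cmod \<xi>) * ((cmod (y1 s))\<^sup>2 + (cmod (y2 s))\<^sup>2) + (cmod (y3 s))\<^sup>2 + (cmod (y4 s))\<^sup>2"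

text \<open>Gronwall with a constant \<open>c\<close> common to all \<xi> and t. The interval ends
  at a variable \<open>t\<close> because a solution of the Rayleigh system is given only on the open
  half-line, so the estimate has to be usable before reaching 0.\<close>

lemma energy_growth:
  "\<exists>c\<ge>0. \<forall>\<xi> y1 y2 y3 y4 t. t \<in> {-H..0} \<longrightarrow> rayleigh_ode \<xi> {-H..t} y1 y2 y3 y4 \<longrightarrow>
    energy \<xi> y1 y2 y3 y4 t
      \<le> energy \<xi> y1 y2 y3 y4 (- H) * exp (2 * (\<bar>Re \<xi>\<bar> + 2 * c * sqrt (1 + cmod \<xi>)) * (t + H))"
proof -
  have bdd: "\<exists>K. \<forall>s\<in>{-H..0}. \<bar>f s\<bar> \<le> K" if "continuous_on {..0} f" for f :: "real \<Rightarrow> real"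
  proof -
    have "compact (f ` {-H..0})"
      by (intro compact_continuous_image continuous_on_subset[OF that]) auto
    then show ?thesis
      using compact_imp_bounded by (fastforce simp: bounded_iff)
  qed
  have "continuous_on {..0} (\<lambda>s. 1 / mu s)" "continuous_on {..0} (\<lambda>s. 1 / (lam s + 2 * mu s))"
    using mu_pos sigma_pos by (intro continuous_intros lam_cont mu_cont; force)+
  note this[THEN bdd]
  then obtain k1 k2 where k: "\<forall>s\<in>{-H..0}. \<bar>1 / mu s\<bar> \<le> k1"
      "\<forall>s\<in>{-H..0}. \<bar>1 / (lam s + 2 * mu s)\<bar> \<le> k2"
    by (elim exE)
  obtain k3 where k3: "\<forall>s\<in>{-H..0}. \<bar>mu' s\<bar> \<le> k3"
    using bdd[OF mu'_cont] by (elim exE)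
  define c where "c = Max {k1, k2, k3, \<omega>\<^sup>2}"
  have c: "k1 \<le> c" "k2 \<le> c" "k3 \<le> c" "\<omega>\<^sup>2 \<le> c"
    by (simp_all add: c_def)
  then have "0 \<le> c"
    using zero_le_power2[of \<omega>] by linarith
  moreover have "energy \<xi> y1 y2 y3 y4 t
      \<le> energy \<xi> y1 y2 y3 y4 (- H) * exp (2 * (\<bar>Re \<xi>\<bar> + 2 * c * sqrt (1 + cmod \<xi>)) * (t + H))"
    if t: "t \<in> {-H..0}" and ode: "rayleigh_ode \<xi> {-H..t} y1 y2 y3 y4" for \<xi> y1 y2 y3 y4 t
  proof -
    define K where "K = 2 * (\<bar>Re \<xi>\<bar> + 2 * c * sqrt (1 + cmod \<xi>))"
    let ?E = "energy \<xi> y1 y2 y3 y4"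
    have "?E (- H) * exp (- (K * (- H))) \<ge> ?E t * exp (- (K * t))"
    proof (rule DERIV_nonpos_imp_decreasing_open[where f = "\<lambda>s. ?E s * exp (- (K * s))"])
      show "- H \<le> t" using t by simp
      have "continuous_on {-H..t} y1" "continuous_on {-H..t} y2" "continuous_on {-H..t} y3" "continuous_on {-H..t} y4"
        using ode unfolding rayleigh_ode_def
        by (auto simp: continuous_on_eq_continuous_within intro: has_vector_derivative_continuous)
      then show "continuous_on {-H..t} (\<lambda>s. ?E s * exp (- (K * s)))"
        unfolding energy_def by (intro continuous_intros)
      fix s assume s: "- H < s" "s < t"
      define d1 where "d1 = - \<xi> * y2 s + of_real (1 / mu s) * y4 s"
      define d2 where "d2 = - \<xi> * y1 s + of_real (1 / (lam s + 2 * mu s)) * y3 s"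
      define d3 where "d3 = \<xi> * y4 s + 2 * of_real (mu' s) * \<xi> * y1 s - of_real (\<omega>\<^sup>2) * y2 s"
      define d4 where "d4 = \<xi> * y3 s + 2 * of_real (mu' s) * \<xi> * y2 s - of_real (\<omega>\<^sup>2) * y1 s"
      have "at s within {-H..t} = at s"
        using s by (intro at_within_interior) auto
      then have d: "(y1 has_vector_derivative d1) (at s)" "(y2 has_vector_derivative d2) (at s)"
        "(y3 has_vector_derivative d3) (at s)" "(y4 has_vector_derivative d4) (at s)"
        using ode s unfolding rayleigh_ode_def d1_def d2_def d3_def d4_def by (auto dest!: bspec[of _ _ s])
      define D where "D = 2 * ((1 + cmod \<xi>) * (y1 s \<bullet> d1 + y2 s \<bullet> d2) + (y3 s \<bullet> d3 + y4 s \<bullet> d4))"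
      have "(?E has_real_derivative D) (at s)"
      proof -
        have "(?E has_real_derivative (1 + cmod \<xi>) * (2 * (y1 s \<bullet> d1) + 2 * (y2 s \<bullet> d2))
            + 2 * (y3 s \<bullet> d3) + 2 * (y4 s \<bullet> d4)) (at s)"
          unfolding energy_def by (intro DERIV_add DERIV_cmult has_real_derivative_norm_square d)
        then show ?thesis by (simp add: D_def algebra_simps)
      qed
      then have "((\<lambda>s. ?E s * exp (- (K * s))) has_real_derivative (D - K * ?E s) * exp (- (K * s))) (at s)"
        by (auto intro!: derivative_eq_intros simp: algebra_simps)
      moreover have "D \<le> K * ?E s"
      proof -
        have "s \<in> {-H..0}" using s t by simp
        then have le: "\<bar>1 / mu s\<bar> \<le> c" "\<bar>1 / (lam s + 2 * mu s)\<bar> \<le> c" "\<bar>mu' s\<bar> \<le> c" "\<bar>\<omega>\<^sup>2\<bar> \<le> c"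
          using k k3 c by (auto intro: order_trans simp del: abs_divide)
        have "(1 + cmod \<xi>) * (y1 s \<bullet> d1 + y2 s \<bullet> d2) + (y3 s \<bullet> d3 + y4 s \<bullet> d4)
            \<le> (\<bar>Re \<xi>\<bar> + 2 * c * sqrt (1 + cmod \<xi>)) * ?E s"
          unfolding energy_def d1_def d2_def d3_def d4_def by (rule energy_algebra[OF le])
        then show ?thesis
          unfolding D_def K_def by (simp only: mult.assoc[of 2]) simp
      qed
      ultimately show "\<exists>y. ((\<lambda>s. ?E s * exp (- (K * s))) has_real_derivative y) (at s) \<and> y \<le> 0"
        by (intro exI conjI) (assumption, simp add: mult_le_0_iff)
    qed
    then have "?E t * exp (- (K * t)) * exp (K * t) \<le> ?E (- H) * exp (- (K * (- H))) * exp (K * t)"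
      by (intro mult_right_mono) auto
    moreover have "?E t * exp (- (K * t)) * exp (K * t) = ?E t"
      unfolding mult.assoc exp_add[symmetric] by simp
    moreover have "?E (- H) * exp (- (K * (- H))) * exp (K * t) = ?E (- H) * exp (K * (t + H))"
      unfolding mult.assoc exp_add[symmetric] by (simp add: algebra_simps)
    ultimately show ?thesis
      unfolding K_def[symmetric] by (simp only:)
  qed
  ultimately show ?thesis by blast
qed

text \<open>The difference of the two solutions starts with zero energy, and the growth bound keeps
  it zero.\<close>

lemma rayleigh_ode_unique:
  assumes "t \<in> {-H..0}" "rayleigh_ode \<xi> {-H..t} y1 y2 y3 y4" "rayleigh_ode \<xi> {-H..t} z1 z2 z3 z4"
    and "y1 (- H) = z1 (- H)" "y2 (- H) = z2 (- H)" "y3 (- H) = z3 (- H)" "y4 (- H) = z4 (- H)"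
  shows "y1 t = z1 t" "y2 t = z2 t" "y3 t = z3 t" "y4 t = z4 t"
proof -
  let ?d = "\<lambda>y z s. y s + - 1 * (z s :: complex)"
  have "rayleigh_ode \<xi> {-H..t} (?d y1 z1) (?d y2 z2) (?d y3 z3) (?d y4 z4)"
    by (intro rayleigh_ode_add rayleigh_ode_scale assms)
  moreover have "energy \<xi> (?d y1 z1) (?d y2 z2) (?d y3 z3) (?d y4 z4) (- H) = 0"
    using assms by (simp add: energy_def)
  moreover obtain c where "energy \<xi> (?d y1 z1) (?d y2 z2) (?d y3 z3) (?d y4 z4) t
      \<le> energy \<xi> (?d y1 z1) (?d y2 z2) (?d y3 z3) (?d y4 z4) (- H)
        * exp (2 * (\<bar>Re \<xi>\<bar> + 2 * c * sqrt (1 + cmod \<xi>)) * (t + H))"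
    using energy_growth assms(1) calculation(1) by meson
  ultimately have "energy \<xi> (?d y1 z1) (?d y2 z2) (?d y3 z3) (?d y4 z4) t \<le> 0"
    by simp
  then have "(1 + cmod \<xi>) * ((cmod (?d y1 z1 t))\<^sup>2 + (cmod (?d y2 z2 t))\<^sup>2) + (cmod (?d y3 z3 t))\<^sup>2
      + (cmod (?d y4 z4 t))\<^sup>2 \<le> 0"
    by (simp only: energy_def)
  moreover have "(cmod (?d y1 z1 t))\<^sup>2 + (cmod (?d y2 z2 t))\<^sup>2
      \<le> (1 + cmod \<xi>) * ((cmod (?d y1 z1 t))\<^sup>2 + (cmod (?d y2 z2 t))\<^sup>2)"
    using mult_right_mono[of 1 "1 + cmod \<xi>" "(cmod (?d y1 z1 t))\<^sup>2 + (cmod (?d y2 z2 t))\<^sup>2"] by simp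
  ultimately have "(cmod (?d y1 z1 t))\<^sup>2 + (cmod (?d y2 z2 t))\<^sup>2 + (cmod (?d y3 z3 t))\<^sup>2
      + (cmod (?d y4 z4 t))\<^sup>2 \<le> 0"
    by linarith
  then have "(cmod (?d y1 z1 t))\<^sup>2 = 0 \<and> (cmod (?d y2 z2 t))\<^sup>2 = 0 \<and> (cmod (?d y3 z3 t))\<^sup>2 = 0
      \<and> (cmod (?d y4 z4 t))\<^sup>2 = 0"
    by (smt (verit) zero_le_power2)
  then show "y1 t = z1 t" "y2 t = z2 t" "y3 t = z3 t" "y4 t = z4 t"
    by simp_all
qed

end

section \<open>Passage between the Rayleigh system and the first-order system\<close>

lemma has_vector_derivative_vec_nth_iff:
  fixes f :: "real \<Rightarrow> complex ^ 'n"
  shows "(f has_vector_derivative D) (at Z) \<longleftrightarrow> (\<forall>i. ((\<lambda>t. f t $ i) has_vector_derivative D $ i) (at Z))"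
proof
  assume "(f has_vector_derivative D) (at Z)"
  then show "\<forall>i. ((\<lambda>t. f t $ i) has_vector_derivative D $ i) (at Z)"
    using bounded_linear.has_vector_derivative[OF bounded_linear_vec_nth] by blast
next
  assume *: "\<forall>i. ((\<lambda>t. f t $ i) has_vector_derivative D $ i) (at Z)"
  have "((\<lambda>y. ((f y - f Z) - (y - Z) *\<^sub>R D) /\<^sub>R norm (y - Z)) \<longlongrightarrow> 0) (at Z)"
    using * unfolding has_vector_derivative_def has_derivative_at_within
    by (intro vec_tendstoI) simp
  then show "(f has_vector_derivative D) (at Z)"
    unfolding has_vector_derivative_def has_derivative_at_within
    by (simp add: bounded_linear_scaleR_left)
qed

lemma rayleigh_equation_components:
  "g + \<xi> *s (N_mat lam mu Z *v p - n) + (mat (of_real (\<omega>\<^sup>2)) - mat (\<xi>\<^sup>2) ** M_mat lam mu Z) *v x = 0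
    \<longleftrightarrow> g $ 1 + \<xi> * (- of_real (lam Z) * p $ 2 - n $ 1) + (of_real (\<omega>\<^sup>2) - \<xi>\<^sup>2 * of_real (lam Z + 2 * mu Z)) * x $ 1 = 0
      \<and> g $ 2 + \<xi> * (of_real (mu Z) * p $ 1 - n $ 2) + (of_real (\<omega>\<^sup>2) - \<xi>\<^sup>2 * of_real (mu Z)) * x $ 2 = 0"
  by (simp add: vec_eq_iff forall_2 matrix_vector_mult_def matrix_matrix_mult_def sum_2 mat_def N_mat_def M_mat_def
      right_diff_distrib)

lemma P_mat_mult: "P_mat lam mu t *v p = vector [of_real (mu t) * p $ 1, of_real (lam t + 2 * mu t) * p $ 2]"
  by (simp add: vec_eq_iff forall_2 matrix_vector_mult_def sum_2 P_mat_def)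

lemma N_mat_transpose_mult:
  "transpose (N_mat lam mu t) *v x = vector [of_real (mu t) * x $ 2, - of_real (lam t) * x $ 1]"
  by (simp add: vec_eq_iff forall_2 matrix_vector_mult_def sum_2 N_mat_def transpose_def)

lemma has_vector_derivative_of_real_mult:
  assumes "(f has_real_derivative d) (at Z)" "(u has_vector_derivative v) (at Z)"
  shows "((\<lambda>t. complex_of_real (f t) * u t) has_vector_derivative of_real d * u Z + of_real (f Z) * v) (at Z)"
  using has_vector_derivative_mult[OF has_vector_derivative_of_real[OF assms(1)] assms(2)]
  by (simp add: add.commute)

context rayleigh_medium
begin

lemma lam_deriv_at: "Z < 0 \<Longrightarrow> (lam has_real_derivative lam' Z) (at Z)"
  using lam_deriv[of Z] at_within_interior[of Z "{..0}"] by simp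

lemma mu_deriv_at: "Z < 0 \<Longrightarrow> (mu has_real_derivative mu' Z) (at Z)"
  using mu_deriv[of Z] at_within_interior[of Z "{..0}"] by simp

lemma sigma_deriv_at:
  "Z < 0 \<Longrightarrow> ((\<lambda>t. lam t + 2 * mu t) has_real_derivative lam' Z + 2 * mu' Z) (at Z)"
  by (auto intro!: derivative_eq_intros lam_deriv_at mu_deriv_at)

lemma transpose_N_derivative:
  fixes \<psi> :: "real \<Rightarrow> complex ^ 2" and p :: "complex ^ 2"
  assumes "Z < 0" "(\<psi> has_vector_derivative p) (at Z)"
  shows "((\<lambda>t. transpose (N_mat lam mu t) *v \<psi> t) has_vector_derivative
    vector [of_real (mu' Z) * \<psi> Z $ 2 + of_real (mu Z) * p $ 2,
      - (of_real (lam' Z) * \<psi> Z $ 1 + of_real (lam Z) * p $ 1)]) (at Z)"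
  unfolding has_vector_derivative_vec_nth_iff N_mat_transpose_mult forall_2
  using assms(2)[unfolded has_vector_derivative_vec_nth_iff]
    has_vector_derivative_minus[OF has_vector_derivative_of_real_mult[OF lam_deriv_at[OF \<open>Z < 0\<close>]]]
  by (auto intro!: has_vector_derivative_of_real_mult mu_deriv_at \<open>Z < 0\<close>)

text \<open>The third and fourth variables are components of \<open>P \<psi>'\<close> plus \<xi>
  times a differentiable term, so their derivatives exist although a second derivative of
  \<open>\<psi>\<close> is not assumed. The added terms cancel \<open>lam'\<close> against
  \<open>(N\<^sup>T \<psi>)'\<close> and complete the \<xi>^2 term to \<xi> times the other new
  variable, which leaves a system affine in \<xi>.\<close>

lemma rayleigh_solution_imp_ode:
  assumes sol: "rayleigh_solution \<omega> lam mu \<xi> \<psi>"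
  shows "rayleigh_ode \<xi> {..<0} (\<lambda>s. \<psi> s $ 1) (\<lambda>s. \<psi> s $ 2)
    (\<lambda>s. of_real (lam s + 2 * mu s) * (vderiv \<psi> s $ 2 + \<xi> * \<psi> s $ 1))
    (\<lambda>s. of_real (mu s) * (vderiv \<psi> s $ 1 + \<xi> * \<psi> s $ 2))"
  unfolding rayleigh_ode_def
proof
  fix Z :: real assume "Z \<in> {..<0}"
  then have Z: "Z < 0" by simp
  define p where "p = vderiv \<psi> Z"
  define G where "G t = P_mat lam mu t *v vderiv \<psi> t" for t
  define g where "g = vderiv G Z"
  define n where "n = vderiv (\<lambda>t. transpose (N_mat lam mu t) *v \<psi> t) Z"
  have \<psi>: "(\<psi> has_vector_derivative p) (at Z)" and G: "(G has_vector_derivative g) (at Z)"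
    using sol Z unfolding rayleigh_solution_def p_def g_def G_def vderiv_def
    by (auto simp: vector_derivative_works[symmetric])
  have n: "n = vector [of_real (mu' Z) * \<psi> Z $ 2 + of_real (mu Z) * p $ 2,
      - (of_real (lam' Z) * \<psi> Z $ 1 + of_real (lam Z) * p $ 1)]"
    unfolding n_def vderiv_def by (rule vector_derivative_at[OF transpose_N_derivative[OF Z \<psi>]])
  have "g + \<xi> *s (N_mat lam mu Z *v p - n) + (mat (of_real (\<omega>\<^sup>2)) - mat (\<xi>\<^sup>2) ** M_mat lam mu Z) *v \<psi> Z = 0"
    using sol Z unfolding rayleigh_solution_def p_def g_def G_def n_def by blast
  then have eq1: "g $ 1 = - (\<xi> * (- of_real (lam Z) * p $ 2 - n $ 1)
        + (of_real (\<omega>\<^sup>2) - \<xi>\<^sup>2 * of_real (lam Z + 2 * mu Z)) * \<psi> Z $ 1)"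
    and eq2: "g $ 2 = - (\<xi> * (of_real (mu Z) * p $ 1 - n $ 2)
        + (of_real (\<omega>\<^sup>2) - \<xi>\<^sup>2 * of_real (mu Z)) * \<psi> Z $ 2)"
    unfolding rayleigh_equation_components by (simp_all only: add.assoc eq_neg_iff_add_eq_0)
  have d\<psi>: "((\<lambda>t. \<psi> t $ 1) has_vector_derivative p $ 1) (at Z)" "((\<lambda>t. \<psi> t $ 2) has_vector_derivative p $ 2) (at Z)"
    using \<psi> unfolding has_vector_derivative_vec_nth_iff by auto
  have dG: "((\<lambda>t. of_real (mu t) * vderiv \<psi> t $ 1) has_vector_derivative g $ 1) (at Z)"
    "((\<lambda>t. of_real (lam t + 2 * mu t) * vderiv \<psi> t $ 2) has_vector_derivative g $ 2) (at Z)"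
    using G unfolding has_vector_derivative_vec_nth_iff G_def P_mat_mult forall_2 by simp_all
  have nz: "complex_of_real (mu Z) \<noteq> 0" "complex_of_real (lam Z + 2 * mu Z) \<noteq> 0"
    using mu_pos[of Z] sigma_pos[of Z] Z by (simp_all del: of_real_add of_real_mult)
  have "((\<lambda>s. of_real (lam s + 2 * mu s) * vderiv \<psi> s $ 2 + \<xi> * (of_real (lam s + 2 * mu s) * \<psi> s $ 1))
      has_vector_derivative g $ 2 + \<xi> * (of_real (lam' Z + 2 * mu' Z) * \<psi> Z $ 1 + of_real (lam Z + 2 * mu Z) * p $ 1)) (at Z)"
    by (intro has_vector_derivative_add dG has_vector_derivative_mult_right
        has_vector_derivative_of_real_mult sigma_deriv_at Z d\<psi>)
  also have "g $ 2 + \<xi> * (of_real (lam' Z + 2 * mu' Z) * \<psi> Z $ 1 + of_real (lam Z + 2 * mu Z) * p $ 1)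
      = \<xi> * (of_real (mu Z) * (p $ 1 + \<xi> * \<psi> Z $ 2)) + 2 * of_real (mu' Z) * \<xi> * \<psi> Z $ 1 - of_real (\<omega>\<^sup>2) * \<psi> Z $ 2"
    unfolding eq2 n by (simp add: algebra_simps power2_eq_square)
  also have "(\<lambda>s. of_real (lam s + 2 * mu s) * vderiv \<psi> s $ 2 + \<xi> * (of_real (lam s + 2 * mu s) * \<psi> s $ 1))
      = (\<lambda>s. of_real (lam s + 2 * mu s) * (vderiv \<psi> s $ 2 + \<xi> * \<psi> s $ 1))"
    by (simp add: distrib_left mult.left_commute)
  finally have d3: "((\<lambda>s. of_real (lam s + 2 * mu s) * (vderiv \<psi> s $ 2 + \<xi> * \<psi> s $ 1)) has_vector_derivative
      \<xi> * (of_real (mu Z) * (p $ 1 + \<xi> * \<psi> Z $ 2)) + 2 * of_real (mu' Z) * \<xi> * \<psi> Z $ 1 - of_real (\<omega>\<^sup>2) * \<psi> Z $ 2) (at Z)"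
    .
  have "((\<lambda>s. of_real (mu s) * vderiv \<psi> s $ 1 + \<xi> * (of_real (mu s) * \<psi> s $ 2))
      has_vector_derivative g $ 1 + \<xi> * (of_real (mu' Z) * \<psi> Z $ 2 + of_real (mu Z) * p $ 2)) (at Z)"
    by (intro has_vector_derivative_add dG has_vector_derivative_mult_right
        has_vector_derivative_of_real_mult mu_deriv_at Z d\<psi>)
  also have "g $ 1 + \<xi> * (of_real (mu' Z) * \<psi> Z $ 2 + of_real (mu Z) * p $ 2)
      = \<xi> * (of_real (lam Z + 2 * mu Z) * (p $ 2 + \<xi> * \<psi> Z $ 1)) + 2 * of_real (mu' Z) * \<xi> * \<psi> Z $ 2 - of_real (\<omega>\<^sup>2) * \<psi> Z $ 1"
    unfolding eq1 n by (simp add: algebra_simps power2_eq_square)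
  also have "(\<lambda>s. of_real (mu s) * vderiv \<psi> s $ 1 + \<xi> * (of_real (mu s) * \<psi> s $ 2))
      = (\<lambda>s. of_real (mu s) * (vderiv \<psi> s $ 1 + \<xi> * \<psi> s $ 2))"
    by (simp add: distrib_left mult.left_commute)
  finally have d4: "((\<lambda>s. of_real (mu s) * (vderiv \<psi> s $ 1 + \<xi> * \<psi> s $ 2)) has_vector_derivative
      \<xi> * (of_real (lam Z + 2 * mu Z) * (p $ 2 + \<xi> * \<psi> Z $ 1)) + 2 * of_real (mu' Z) * \<xi> * \<psi> Z $ 2 - of_real (\<omega>\<^sup>2) * \<psi> Z $ 1) (at Z)"
    .
  have within: "at Z within {..<0} = at Z"
    using Z by (intro at_within_open) auto
  have e1: "p $ 1 = - \<xi> * \<psi> Z $ 2 + of_real (1 / mu Z) * (of_real (mu Z) * (p $ 1 + \<xi> * \<psi> Z $ 2))"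
    using nz by simp
  have e2: "p $ 2 = - \<xi> * \<psi> Z $ 1 + of_real (1 / (lam Z + 2 * mu Z)) * (of_real (lam Z + 2 * mu Z) * (p $ 2 + \<xi> * \<psi> Z $ 1))"
  proof -
    have "of_real (1 / (lam Z + 2 * mu Z)) * (of_real (lam Z + 2 * mu Z) * (p $ 2 + \<xi> * \<psi> Z $ 1)) = p $ 2 + \<xi> * \<psi> Z $ 1"
      using nz(2) by (simp del: of_real_add of_real_mult)
    then show ?thesis by simp
  qed
  note d1 = has_vector_derivative_eq_rhs[OF d\<psi>(1) e1] and d2 = has_vector_derivative_eq_rhs[OF d\<psi>(2) e2]
  show "((\<lambda>s. \<psi> s $ 1) has_vector_derivative
        - \<xi> * \<psi> Z $ 2 + of_real (1 / mu Z) * (of_real (mu Z) * (vderiv \<psi> Z $ 1 + \<xi> * \<psi> Z $ 2))) (at Z within {..<0}) \<and>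
      ((\<lambda>s. \<psi> s $ 2) has_vector_derivative
        - \<xi> * \<psi> Z $ 1 + of_real (1 / (lam Z + 2 * mu Z)) * (of_real (lam Z + 2 * mu Z) * (vderiv \<psi> Z $ 2 + \<xi> * \<psi> Z $ 1))) (at Z within {..<0}) \<and>
      ((\<lambda>s. of_real (lam s + 2 * mu s) * (vderiv \<psi> s $ 2 + \<xi> * \<psi> s $ 1)) has_vector_derivative
        \<xi> * (of_real (mu Z) * (vderiv \<psi> Z $ 1 + \<xi> * \<psi> Z $ 2)) + 2 * of_real (mu' Z) * \<xi> * \<psi> Z $ 1 - of_real (\<omega>\<^sup>2) * \<psi> Z $ 2) (at Z within {..<0}) \<and>
      ((\<lambda>s. of_real (mu s) * (vderiv \<psi> s $ 1 + \<xi> * \<psi> s $ 2)) has_vector_derivative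
        \<xi> * (of_real (lam Z + 2 * mu Z) * (vderiv \<psi> Z $ 2 + \<xi> * \<psi> Z $ 1)) + 2 * of_real (mu' Z) * \<xi> * \<psi> Z $ 2 - of_real (\<omega>\<^sup>2) * \<psi> Z $ 1) (at Z within {..<0})"
    unfolding within p_def[symmetric] by (intro conjI d1 d2 d3 d4)
qed

lemma ode_imp_rayleigh_solution:
  assumes ode: "rayleigh_ode \<xi> {..<0} y1 y2 y3 y4"
  shows "rayleigh_solution \<omega> lam mu \<xi> (\<lambda>s. vector [y1 s, y2 s])" (is "rayleigh_solution _ _ _ _ ?\<psi>")
proof -
  define p where "p t = (vector [- \<xi> * y2 t + of_real (1 / mu t) * y4 t,
    - \<xi> * y1 t + of_real (1 / (lam t + 2 * mu t)) * y3 t] :: complex ^ 2)" for t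
  have within: "at t within {..<0} = at t" if "t < 0" for t :: real
    using that by (intro at_within_open) auto
  have d: "(y1 has_vector_derivative p t $ 1) (at t)" "(y2 has_vector_derivative p t $ 2) (at t)"
    "(y3 has_vector_derivative \<xi> * y4 t + 2 * of_real (mu' t) * \<xi> * y1 t - of_real (\<omega>\<^sup>2) * y2 t) (at t)"
    "(y4 has_vector_derivative \<xi> * y3 t + 2 * of_real (mu' t) * \<xi> * y2 t - of_real (\<omega>\<^sup>2) * y1 t) (at t)"
    if "t < 0" for t
    using ode[unfolded rayleigh_ode_def, rule_format, of t] within[OF that] that
    by (simp_all only: p_def vector_2 lessThan_iff)
  have d\<psi>: "(?\<psi> has_vector_derivative p t) (at t)" if "t < 0" for t
    using d[OF that] by (simp add: has_vector_derivative_vec_nth_iff forall_2)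
  then have vd: "vderiv ?\<psi> t = p t" if "t < 0" for t
    using that unfolding vderiv_def by (intro vector_derivative_at)
  define G where "G t = P_mat lam mu t *v vderiv ?\<psi> t" for t
  \<comment> \<open>\<open>P \<psi>'\<close> rewritten in the unknowns of the system. Unlike
    \<open>G\<close> it contains no \<open>vderiv\<close>, so it can be differentiated directly, and
    it agrees with \<open>G\<close> on the open half-line.\<close>
  define K where "K t = (vector [y4 t - \<xi> * (of_real (mu t) * y2 t),
    y3 t - \<xi> * (of_real (lam t + 2 * mu t) * y1 t)] :: complex ^ 2)" for t
  have GK: "G t = K t" if "t < 0" for t
  proof -
    have nz: "complex_of_real (mu t) \<noteq> 0" "complex_of_real (lam t + 2 * mu t) \<noteq> 0"
      using mu_pos[of t] sigma_pos[of t] that by (simp_all del: of_real_add of_real_mult)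
    have "of_real (mu t) * p t $ 1 = y4 t - \<xi> * (of_real (mu t) * y2 t)"
      using nz(1) by (simp add: p_def right_diff_distrib)
    moreover have "of_real (lam t + 2 * mu t) * p t $ 2 = y3 t - \<xi> * (of_real (lam t + 2 * mu t) * y1 t)"
      using nz(2) by (simp add: p_def right_diff_distrib del: of_real_add of_real_mult)
    ultimately show ?thesis
      unfolding G_def K_def P_mat_mult vd[OF that] by (simp only:)
  qed
  show ?thesis
    unfolding rayleigh_solution_def G_def[symmetric]
  proof (intro allI impI conjI)
    fix Z :: real assume Z: "Z < 0"
    show "?\<psi> differentiable at Z"
      using d\<psi>[OF Z] by (auto simp: differentiable_def has_vector_derivative_def)
    define g where "g = (vector [\<xi> * y3 Z + 2 * of_real (mu' Z) * \<xi> * y2 Z - of_real (\<omega>\<^sup>2) * y1 Z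
        - \<xi> * (of_real (mu' Z) * y2 Z + of_real (mu Z) * p Z $ 2),
      \<xi> * y4 Z + 2 * of_real (mu' Z) * \<xi> * y1 Z - of_real (\<omega>\<^sup>2) * y2 Z
        - \<xi> * (of_real (lam' Z + 2 * mu' Z) * y1 Z + of_real (lam Z + 2 * mu Z) * p Z $ 1)] :: complex ^ 2)"
    have "((\<lambda>t. y4 t - \<xi> * (of_real (mu t) * y2 t)) has_vector_derivative g $ 1) (at Z)"
      unfolding g_def vector_2
      by (intro has_vector_derivative_diff has_vector_derivative_mult_right
          has_vector_derivative_of_real_mult mu_deriv_at d Z)
    moreover have "((\<lambda>t. y3 t - \<xi> * (of_real (lam t + 2 * mu t) * y1 t)) has_vector_derivative g $ 2) (at Z)"
      unfolding g_def vector_2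
      by (intro has_vector_derivative_diff has_vector_derivative_mult_right
          has_vector_derivative_of_real_mult sigma_deriv_at d Z)
    ultimately have "(K has_vector_derivative g) (at Z)"
      unfolding has_vector_derivative_vec_nth_iff forall_2 K_def by (simp only: vector_2)
    then have G: "(G has_vector_derivative g) (at Z)"
      by (rule has_vector_derivative_transform_within_open[where S = "{..<0}"]) (use Z GK in auto)
    then show "G differentiable at Z"
      by (auto simp: differentiable_def has_vector_derivative_def)
    have vG: "vderiv G Z = g"
      unfolding vderiv_def by (rule vector_derivative_at[OF G])
    have vN: "vderiv (\<lambda>t. transpose (N_mat lam mu t) *v ?\<psi> t) Z = vector [of_real (mu' Z) * y2 Z + of_real (mu Z) * p Z $ 2,
      - (of_real (lam' Z) * y1 Z + of_real (lam Z) * p Z $ 1)]"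
      using vector_derivative_at[OF transpose_N_derivative[OF Z d\<psi>[OF Z]]] by (simp add: vderiv_def)
    have nz: "complex_of_real (mu Z) \<noteq> 0" "complex_of_real (lam Z + 2 * mu Z) \<noteq> 0"
      using mu_pos[of Z] sigma_pos[of Z] Z by (simp_all del: of_real_add of_real_mult)
    have y4: "y4 Z = of_real (mu Z) * (p Z $ 1 + \<xi> * y2 Z)"
      using nz(1) by (simp add: p_def)
    have y3: "y3 Z = of_real (lam Z + 2 * mu Z) * (p Z $ 2 + \<xi> * y1 Z)"
      using nz(2) by (simp add: p_def del: of_real_add of_real_mult)
    show "vderiv G Z + \<xi> *s (N_mat lam mu Z *v vderiv ?\<psi> Z - vderiv (\<lambda>t. transpose (N_mat lam mu t) *v ?\<psi> t) Z)
        + (mat (of_real (\<omega>\<^sup>2)) - mat (\<xi>\<^sup>2) ** M_mat lam mu Z) *v ?\<psi> Z = 0"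
      unfolding vG vN vd[OF Z] rayleigh_equation_components vector_2 g_def y3 y4 of_real_add of_real_mult of_real_numeral
      by (intro conjI; algebra)
  qed
qed

end

section \<open>Jost solutions and the Rayleigh determinant\<close>

lemma has_vector_derivative_glue:
  fixes y z :: "real \<Rightarrow> 'a::real_normed_vector"
  assumes "c \<le> d" "s \<le> d"
    and y: "\<And>s. s \<le> c \<Longrightarrow> (y has_vector_derivative F s) (at s within {..c})"
    and z: "\<And>s. s \<in> {c..d} \<Longrightarrow> (z has_vector_derivative G s) (at s within {c..d})"
    and "y c = z c" "F c = G c"
  shows "((\<lambda>s. if s \<in> {..c} then y s else z s) has_vector_derivative (if s \<in> {..c} then F s else G s)) (at s within {..d})"
proof (rule has_vector_derivative_If_within_closures[where T = "{c..d}"])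
  have cl: "{..c} \<union> closure {..c} \<inter> closure {c..d} = {..c}" "{c..d} \<union> closure {..c} \<inter> closure {c..d} = {c..d}"
    using assms by auto
  show "(y has_vector_derivative F s) (at s within {..c} \<union> closure {..c} \<inter> closure {c..d})"
    if "s \<in> {..c} \<union> closure {..c} \<inter> closure {c..d}"
    using that y unfolding cl by simp
  show "(z has_vector_derivative G s) (at s within {c..d} \<union> closure {..c} \<inter> closure {c..d})"
    if "s \<in> {c..d} \<union> closure {..c} \<inter> closure {c..d}"
    using that z unfolding cl by simp
  show "y s = z s" "F s = G s" if "s \<in> closure {..c}" "s \<in> closure {c..d}"
    using that assms by (auto dest: antisym)
qed (use assms in auto)

lemma has_vector_derivative_plane_wave:
  "((\<lambda>s. exp (- (\<i> * of_real s * q)) * w) has_vector_derivative - (\<i> * q) * (exp (- (\<i> * of_real s * q)) * w))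
    (at s within S)"
proof -
  have "((\<lambda>z. exp (- (\<i> * z * q)) * w) has_field_derivative - (\<i> * q) * (exp (- (\<i> * of_real s * q)) * w))
      (at (of_real s))"
    by (auto intro!: derivative_eq_intros)
  then show ?thesis
    by (rule has_vector_derivative_real_field)
qed

context rayleigh_medium
begin

lemma fundamental_solutions_exist:
  "\<exists>Y :: complex \<Rightarrow> 4 \<Rightarrow> 4 \<Rightarrow> real \<Rightarrow> complex.
    (\<forall>\<xi> k i. Y \<xi> k i (- H) = (if i = k then 1 else 0)) \<and>
    (\<forall>\<xi> k. rayleigh_ode \<xi> {-H..0} (Y \<xi> k 1) (Y \<xi> k 2) (Y \<xi> k 3) (Y \<xi> k 4)) \<and>
    (\<forall>k i. \<forall>s\<in>{-H..0}. (\<lambda>\<xi>. Y \<xi> k i s) holomorphic_on UNIV)"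
proof -
  define P :: "4 \<Rightarrow> 4 \<Rightarrow> real \<Rightarrow> complex" where
    "P = (\<lambda>i j. if i = 1 \<and> j = 4 then (\<lambda>s. of_real (1 / mu s))
      else if i = 2 \<and> j = 3 then (\<lambda>s. of_real (1 / (lam s + 2 * mu s)))
      else if i = 3 \<and> j = 2 \<or> i = 4 \<and> j = 1 then (\<lambda>s. - of_real (\<omega>\<^sup>2)) else (\<lambda>s. 0))"
  define Q :: "4 \<Rightarrow> 4 \<Rightarrow> real \<Rightarrow> complex" where
    "Q = (\<lambda>i j. if i = 1 \<and> j = 2 \<or> i = 2 \<and> j = 1 then (\<lambda>s. - 1)
      else if i = 3 \<and> j = 4 \<or> i = 4 \<and> j = 3 then (\<lambda>s. 1)
      else if i = 3 \<and> j = 1 \<or> i = 4 \<and> j = 2 then (\<lambda>s. 2 * of_real (mu' s)) else (\<lambda>s. 0))"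
  have "continuous_on {-H..0} lam" "continuous_on {-H..0} mu" "continuous_on {-H..0} mu'"
    by (auto intro: continuous_on_subset[OF lam_cont] continuous_on_subset[OF mu_cont] continuous_on_subset[OF mu'_cont])
  moreover have "\<forall>s\<in>{-H..0}. mu s \<noteq> 0" "\<forall>s\<in>{-H..0}. lam s + 2 * mu s \<noteq> 0"
    using mu_pos sigma_pos by force+
  ultimately have P: "continuous_on {-H..0} (P i j)" and Q: "continuous_on {-H..0} (Q i j)" for i j :: 4
    unfolding P_def Q_def by (auto intro!: continuous_intros simp del: of_real_divide)
  have "\<exists>Y. (\<forall>\<xi> i. Y \<xi> i (- H) = (if i = k then 1 else 0)) \<and>
      (\<forall>\<xi>. rayleigh_ode \<xi> {-H..0} (Y \<xi> 1) (Y \<xi> 2) (Y \<xi> 3) (Y \<xi> 4)) \<and>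
      (\<forall>i. \<forall>s\<in>{-H..0}. (\<lambda>\<xi>. Y \<xi> i s) holomorphic_on UNIV)" for k :: 4
  proof -
    obtain Y where Y: "\<And>\<xi> i. Y \<xi> i (- H) = (if i = k then 1 else 0)"
      "\<And>\<xi> i s. s \<in> {-H..0} \<Longrightarrow> (Y \<xi> i has_vector_derivative
        (\<Sum>j\<in>UNIV. (P i j s + \<xi> * Q i j s) * Y \<xi> j s)) (at s within {-H..0})"
      "\<And>i s. s \<in> {-H..0} \<Longrightarrow> (\<lambda>\<xi>. Y \<xi> i s) holomorphic_on UNIV"
      by (rule linear_ode_entire[where a = "- H" and b = 0 and P = P and Q = Q and v = "\<lambda>i. if i = k then 1 else 0"])
        (use H_pos P Q in auto)
    have "rayleigh_ode \<xi> {-H..0} (Y \<xi> 1) (Y \<xi> 2) (Y \<xi> 3) (Y \<xi> 4)" for \<xi>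
      unfolding rayleigh_ode_def
    proof (intro ballI conjI)
      fix s assume "s \<in> {-H..0}"
      note d = Y(2)[OF this, THEN has_vector_derivative_eq_rhs, unfolded sum_4]
      show "(Y \<xi> 1 has_vector_derivative - \<xi> * Y \<xi> 2 s + of_real (1 / mu s) * Y \<xi> 4 s) (at s within {-H..0})"
        by (rule d) (simp add: P_def Q_def)
      show "(Y \<xi> 2 has_vector_derivative - \<xi> * Y \<xi> 1 s + of_real (1 / (lam s + 2 * mu s)) * Y \<xi> 3 s) (at s within {-H..0})"
        by (rule d) (simp add: P_def Q_def)
      show "(Y \<xi> 3 has_vector_derivative \<xi> * Y \<xi> 4 s + 2 * of_real (mu' s) * \<xi> * Y \<xi> 1 s - of_real (\<omega>\<^sup>2) * Y \<xi> 2 s) (at s within {-H..0})"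
        by (rule d) (simp add: P_def Q_def algebra_simps)
      show "(Y \<xi> 4 has_vector_derivative \<xi> * Y \<xi> 3 s + 2 * of_real (mu' s) * \<xi> * Y \<xi> 2 s - of_real (\<omega>\<^sup>2) * Y \<xi> 1 s) (at s within {-H..0})"
        by (rule d) (simp add: P_def Q_def algebra_simps)
    qed
    then show ?thesis using Y by blast
  qed
  then obtain Y :: "4 \<Rightarrow> complex \<Rightarrow> 4 \<Rightarrow> real \<Rightarrow> complex" where "\<And>k. (\<forall>\<xi> i. Y k \<xi> i (- H) = (if i = k then 1 else 0)) \<and>
      (\<forall>\<xi>. rayleigh_ode \<xi> {-H..0} (Y k \<xi> 1) (Y k \<xi> 2) (Y k \<xi> 3) (Y k \<xi> 4)) \<and>
      (\<forall>i. \<forall>s\<in>{-H..0}. (\<lambda>\<xi>. Y k \<xi> i s) holomorphic_on UNIV)"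
    by metis
  then show ?thesis
    by (intro exI[of _ "\<lambda>\<xi> k. Y k \<xi>"]) simp
qed

text \<open>Fundamental matrix normalised at -H: \<open>k\<close> numbers the unit initial vector
  and \<open>i\<close> the component. It is chosen for all \<xi> simultaneously, so that holomorphy
  in \<xi> can be part of the choice.\<close>

definition fund :: "complex \<Rightarrow> 4 \<Rightarrow> 4 \<Rightarrow> real \<Rightarrow> complex" where
  "fund = (SOME Y. (\<forall>\<xi> k i. Y \<xi> k i (- H) = (if i = k then 1 else 0)) \<and>
    (\<forall>\<xi> k. rayleigh_ode \<xi> {-H..0} (Y \<xi> k 1) (Y \<xi> k 2) (Y \<xi> k 3) (Y \<xi> k 4)) \<and>
    (\<forall>k i. \<forall>s\<in>{-H..0}. (\<lambda>\<xi>. Y \<xi> k i s) holomorphic_on UNIV))"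

lemma fund_init: "fund \<xi> k i (- H) = (if i = k then 1 else 0)"
  and fund_ode: "rayleigh_ode \<xi> {-H..0} (fund \<xi> k 1) (fund \<xi> k 2) (fund \<xi> k 3) (fund \<xi> k 4)"
  and fund_holomorphic: "s \<in> {-H..0} \<Longrightarrow> (\<lambda>\<xi>. fund \<xi> k i s) holomorphic_on UNIV"
  using someI_ex[OF fundamental_solutions_exist] unfolding fund_def[symmetric] by auto

lemma fund_tame: "tame (\<lambda>\<xi>. fund \<xi> k i 0)"
proof -
  obtain c where "c \<ge> 0" and c: "\<And>\<xi> y1 y2 y3 y4 t. t \<in> {-H..0} \<Longrightarrow> rayleigh_ode \<xi> {-H..t} y1 y2 y3 y4 \<Longrightarrow>
    energy \<xi> y1 y2 y3 y4 t
      \<le> energy \<xi> y1 y2 y3 y4 (- H) * exp (2 * (\<bar>Re \<xi>\<bar> + 2 * c * sqrt (1 + cmod \<xi>)) * (t + H))"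
    using energy_growth by auto
  \<comment> \<open>The 2 pays for the initial energy, which the weight allows to be 1 + |\<xi>|; 2
    H and 4 c H come from the two terms of the growth rate over length H. The constant is halved
    below because the energy is quadratic.\<close>
  define C where "C = 2 + 2 * H + 4 * c * H"
  have "cmod (fund \<xi> k i 0) \<le> exp (C / 2 * (1 + \<bar>Re \<xi>\<bar> + sqrt (cmod \<xi>)))" for \<xi>
  proof -
    let ?E = "energy \<xi> (fund \<xi> k 1) (fund \<xi> k 2) (fund \<xi> k 3) (fund \<xi> k 4)"
    define r where "r = sqrt (cmod \<xi>)"
    have "0 \<le> r" by (simp add: r_def)
    have "?E (- H) \<le> 1 + cmod \<xi>"
      using exhaust_4[of k] by (elim disjE) (simp_all add: energy_def fund_init)
    also have "\<dots> \<le> exp (2 * r)"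
      unfolding r_def by (rule one_plus_le_exp_sqrt) simp
    finally have init: "?E (- H) \<le> exp (2 * r)" .
    have "sqrt (1 + cmod \<xi>) \<le> sqrt ((1 + r)\<^sup>2)"
      unfolding r_def by (intro real_sqrt_le_mono) (simp add: power2_sum)
    then have "sqrt (1 + cmod \<xi>) \<le> 1 + r"
      using \<open>0 \<le> r\<close> by simp
    then have "2 * (\<bar>Re \<xi>\<bar> + 2 * c * sqrt (1 + cmod \<xi>)) * (0 + H) \<le> 2 * (\<bar>Re \<xi>\<bar> + 2 * c * (1 + r)) * (0 + H)"
      using \<open>0 \<le> c\<close> H_pos by (intro mult_right_mono mult_left_mono add_mono) auto
    then have "exp (2 * (\<bar>Re \<xi>\<bar> + 2 * c * sqrt (1 + cmod \<xi>)) * (0 + H)) \<le> exp (2 * (\<bar>Re \<xi>\<bar> + 2 * c * (1 + r)) * (0 + H))"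
      by simp
    moreover have "?E 0 \<le> ?E (- H) * exp (2 * (\<bar>Re \<xi>\<bar> + 2 * c * sqrt (1 + cmod \<xi>)) * (0 + H))"
      using H_pos fund_ode by (intro c) auto
    moreover have "?E (- H) * exp (2 * (\<bar>Re \<xi>\<bar> + 2 * c * sqrt (1 + cmod \<xi>)) * (0 + H))
        \<le> exp (2 * r) * exp (2 * (\<bar>Re \<xi>\<bar> + 2 * c * (1 + r)) * (0 + H))"
      using init calculation(1) by (intro mult_mono) auto
    moreover have "(cmod (fund \<xi> k i 0))\<^sup>2 \<le> ?E 0"
    proof -
      have le: "x \<le> (1 + cmod \<xi>) * (x + y)" "y \<le> (1 + cmod \<xi>) * (x + y)" if "0 \<le> x" "0 \<le> y" for x y :: real
        using that mult_right_mono[of 1 "1 + cmod \<xi>" "x + y"] by auto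
      have nonneg: "0 \<le> (1 + cmod \<xi>) * ((cmod (fund \<xi> k 1 0))\<^sup>2 + (cmod (fund \<xi> k 2 0))\<^sup>2)"
        by simp
      show ?thesis
        using exhaust_4[of i] le[of "(cmod (fund \<xi> k 1 0))\<^sup>2" "(cmod (fund \<xi> k 2 0))\<^sup>2"] nonneg
        unfolding energy_def by (elim disjE) (simp_all add: add_increasing2 add_increasing)
    qed
    ultimately have "(cmod (fund \<xi> k i 0))\<^sup>2 \<le> exp (2 * r + 2 * (\<bar>Re \<xi>\<bar> + 2 * c * (1 + r)) * (0 + H))"
      unfolding exp_add by linarith
    also have "\<dots> \<le> exp (C * (1 + \<bar>Re \<xi>\<bar> + r))"
    proof -
      have "0 \<le> 2 + 2 * \<bar>Re \<xi>\<bar> + 2 * H + 2 * H * r + 4 * c * H * \<bar>Re \<xi>\<bar>"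
        using \<open>0 \<le> r\<close> \<open>0 \<le> c\<close> H_pos by (intro add_nonneg_nonneg mult_nonneg_nonneg) auto
      then show ?thesis by (simp add: C_def algebra_simps)
    qed
    also have "\<dots> = (exp (C / 2 * (1 + \<bar>Re \<xi>\<bar> + r)))\<^sup>2"
      by (simp add: power2_eq_square flip: exp_add)
    finally show ?thesis
      unfolding r_def by (rule power2_le_imp_le) simp
  qed
  then show ?thesis unfolding tame_def by blast
qed

definition sol :: "complex \<Rightarrow> complex \<Rightarrow> complex \<Rightarrow> complex \<Rightarrow> complex \<Rightarrow> 4 \<Rightarrow> real \<Rightarrow> complex" where
  "sol \<xi> w1 w2 w3 w4 i s = w1 * fund \<xi> 1 i s + w2 * fund \<xi> 2 i s + w3 * fund \<xi> 3 i s + w4 * fund \<xi> 4 i s"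

lemma sol_ode:
  "rayleigh_ode \<xi> {-H..0} (sol \<xi> w1 w2 w3 w4 1) (sol \<xi> w1 w2 w3 w4 2) (sol \<xi> w1 w2 w3 w4 3) (sol \<xi> w1 w2 w3 w4 4)"
  unfolding sol_def[abs_def] by (intro rayleigh_ode_add rayleigh_ode_scale fund_ode)

lemma sol_init:
  "sol \<xi> w1 w2 w3 w4 1 (- H) = w1" "sol \<xi> w1 w2 w3 w4 2 (- H) = w2"
  "sol \<xi> w1 w2 w3 w4 3 (- H) = w3" "sol \<xi> w1 w2 w3 w4 4 (- H) = w4"
  by (simp_all add: sol_def fund_init)

lemma sol_scale: "sol \<xi> (e * w1) (e * w2) (e * w3) (e * w4) i s = e * sol \<xi> w1 w2 w3 w4 i s"
  by (simp add: sol_def algebra_simps)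

lemma sol_continuous: "continuous_on {-H..0} (sol \<xi> w1 w2 w3 w4 i)"
proof -
  have "\<And>s. s \<in> {-H..0} \<Longrightarrow> \<exists>d. (sol \<xi> w1 w2 w3 w4 i has_vector_derivative d) (at s within {-H..0})"
    using sol_ode[of \<xi> w1 w2 w3 w4, unfolded rayleigh_ode_def] exhaust_4[of i] by blast
  then show ?thesis
    unfolding continuous_on_eq_continuous_within using has_vector_derivative_continuous by blast
qed

text \<open>The four equations say that (w1, w2, w3, w4) is an eigenvector, for the eigenvalue -i q,
  of the constant coefficient matrix below -H, where \<open>mu'\<close> vanishes.\<close>

lemma plane_wave_ode:
  assumes eqs: "- (\<i> * q) * w1 = - \<xi> * w2 + of_real (1 / mu0) * w4"
    "- (\<i> * q) * w2 = - \<xi> * w1 + of_real (1 / (lam0 + 2 * mu0)) * w3"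
    "- (\<i> * q) * w3 = \<xi> * w4 - of_real (\<omega>\<^sup>2) * w2" "- (\<i> * q) * w4 = \<xi> * w3 - of_real (\<omega>\<^sup>2) * w1"
  shows "rayleigh_ode \<xi> {..- H} (\<lambda>s. exp (- (\<i> * of_real s * q)) * w1) (\<lambda>s. exp (- (\<i> * of_real s * q)) * w2)
    (\<lambda>s. exp (- (\<i> * of_real s * q)) * w3) (\<lambda>s. exp (- (\<i> * of_real s * q)) * w4)"
  unfolding rayleigh_ode_def
proof (intro ballI conjI)
  fix s assume "s \<in> {..- H}"
  then have s: "mu s = mu0" "lam s = lam0" "mu' s = 0"
    by (auto intro: mu_const_upto lam_const_upto mu'_const_upto)
  define e where "e = exp (- (\<i> * complex_of_real s * q))"
  note d = has_vector_derivative_plane_wave[of q _ s "{..- H}", THEN has_vector_derivative_eq_rhs, folded e_def]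
  note e = arg_cong[where f = "\<lambda>z. e * z"]
  show "((\<lambda>s. exp (- (\<i> * of_real s * q)) * w1) has_vector_derivative
      - \<xi> * (exp (- (\<i> * of_real s * q)) * w2) + of_real (1 / mu s) * (exp (- (\<i> * of_real s * q)) * w4)) (at s within {..- H})"
    by (rule d, unfold e_def[symmetric] s) (use e[OF eqs(1)] in \<open>simp add: algebra_simps\<close>)
  show "((\<lambda>s. exp (- (\<i> * of_real s * q)) * w2) has_vector_derivative
      - \<xi> * (exp (- (\<i> * of_real s * q)) * w1) + of_real (1 / (lam s + 2 * mu s)) * (exp (- (\<i> * of_real s * q)) * w3)) (at s within {..- H})"
    by (rule d, unfold e_def[symmetric] s) (use e[OF eqs(2)] in \<open>simp add: algebra_simps\<close>)
  show "((\<lambda>s. exp (- (\<i> * of_real s * q)) * w3) has_vector_derivative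
      \<xi> * (exp (- (\<i> * of_real s * q)) * w4) + 2 * of_real (mu' s) * \<xi> * (exp (- (\<i> * of_real s * q)) * w1)
      - of_real (\<omega>\<^sup>2) * (exp (- (\<i> * of_real s * q)) * w2)) (at s within {..- H})"
    by (rule d, unfold e_def[symmetric] s) (use e[OF eqs(3)] in \<open>simp add: algebra_simps\<close>)
  show "((\<lambda>s. exp (- (\<i> * of_real s * q)) * w4) has_vector_derivative
      \<xi> * (exp (- (\<i> * of_real s * q)) * w3) + 2 * of_real (mu' s) * \<xi> * (exp (- (\<i> * of_real s * q)) * w2)
      - of_real (\<omega>\<^sup>2) * (exp (- (\<i> * of_real s * q)) * w1)) (at s within {..- H})"
    by (rule d, unfold e_def[symmetric] s) (use e[OF eqs(4)] in \<open>simp add: algebra_simps\<close>)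
qed

text \<open>Both pieces satisfy the same equations, so equal values at -H force equal one-sided
  derivatives there.\<close>

lemma rayleigh_ode_glue:
  assumes y: "rayleigh_ode \<xi> {..- H} y1 y2 y3 y4" and z: "rayleigh_ode \<xi> {-H..0} z1 z2 z3 z4"
    and eq: "y1 (- H) = z1 (- H)" "y2 (- H) = z2 (- H)" "y3 (- H) = z3 (- H)" "y4 (- H) = z4 (- H)"
  defines "g \<equiv> \<lambda>(y::real \<Rightarrow> complex) z s. if s \<in> {..- H} then y s else z s"
  shows "rayleigh_ode \<xi> {..0} (g y1 z1) (g y2 z2) (g y3 z3) (g y4 z4)"
proof -
  have glue: "((\<lambda>s. if s \<in> {..- H} then y s else z s) has_vector_derivative (if s \<in> {..- H} then F s else G s)) (at s within {..0})"
    if "s \<le> 0" "\<And>s. s \<in> {..- H} \<Longrightarrow> (y has_vector_derivative F s) (at s within {..- H})"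
      "\<And>s. s \<in> {-H..0} \<Longrightarrow> (z has_vector_derivative G s) (at s within {-H..0})" "y (- H) = z (- H)" "F (- H) = G (- H)"
    for y z F G :: "real \<Rightarrow> complex" and s
    using H_pos that by (intro has_vector_derivative_glue) auto
  note dy = y[unfolded rayleigh_ode_def, rule_format]
  note dz = z[unfolded rayleigh_ode_def, rule_format]
  show ?thesis
    unfolding rayleigh_ode_def g_def
  proof (intro ballI conjI)
    fix s :: real assume "s \<in> {..0}"
    then have s: "s \<le> 0" by simp
    show "((\<lambda>s. if s \<in> {..- H} then y1 s else z1 s) has_vector_derivative
        - \<xi> * (if s \<in> {..- H} then y2 s else z2 s) + of_real (1 / mu s) * (if s \<in> {..- H} then y4 s else z4 s)) (at s within {..0})"
      by (rule has_vector_derivative_eq_rhs[OF glue[OF s dy[THEN conjunct1] dz[THEN conjunct1]]]) (simp_all add: eq)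
    show "((\<lambda>s. if s \<in> {..- H} then y2 s else z2 s) has_vector_derivative
        - \<xi> * (if s \<in> {..- H} then y1 s else z1 s) + of_real (1 / (lam s + 2 * mu s)) * (if s \<in> {..- H} then y3 s else z3 s)) (at s within {..0})"
      by (rule has_vector_derivative_eq_rhs[OF glue[OF s dy[THEN conjunct2, THEN conjunct1] dz[THEN conjunct2, THEN conjunct1]]])
        (simp_all add: eq)
    show "((\<lambda>s. if s \<in> {..- H} then y3 s else z3 s) has_vector_derivative
        \<xi> * (if s \<in> {..- H} then y4 s else z4 s) + 2 * of_real (mu' s) * \<xi> * (if s \<in> {..- H} then y1 s else z1 s)
        - of_real (\<omega>\<^sup>2) * (if s \<in> {..- H} then y2 s else z2 s)) (at s within {..0})"
      by (rule has_vector_derivative_eq_rhs[OF glue[OF s dy[THEN conjunct2, THEN conjunct2, THEN conjunct1]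
              dz[THEN conjunct2, THEN conjunct2, THEN conjunct1]]])
        (simp_all add: eq)
    show "((\<lambda>s. if s \<in> {..- H} then y4 s else z4 s) has_vector_derivative
        \<xi> * (if s \<in> {..- H} then y3 s else z3 s) + 2 * of_real (mu' s) * \<xi> * (if s \<in> {..- H} then y2 s else z2 s)
        - of_real (\<omega>\<^sup>2) * (if s \<in> {..- H} then y1 s else z1 s)) (at s within {..0})"
      by (rule has_vector_derivative_eq_rhs[OF glue[OF s dy[THEN conjunct2, THEN conjunct2, THEN conjunct2]
              dz[THEN conjunct2, THEN conjunct2, THEN conjunct2]]])
        (simp_all add: eq)
  qed
qed

text \<open>Ensures that \<open>SOME\<close> in the definition of the Jost solutions selects a
  genuine solution. The wave is continued from -H to 0 by the fundamental solutions, with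
  \<open>e\<close> its scalar value at -H.\<close>

lemma jost_solution_exists:
  assumes eqs: "- (\<i> * q) * w1 = - \<xi> * w2 + of_real (1 / mu0) * w4"
    "- (\<i> * q) * w2 = - \<xi> * w1 + of_real (1 / (lam0 + 2 * mu0)) * w3"
    "- (\<i> * q) * w3 = \<xi> * w4 - of_real (\<omega>\<^sup>2) * w2" "- (\<i> * q) * w4 = \<xi> * w3 - of_real (\<omega>\<^sup>2) * w1"
  shows "\<exists>\<psi>. rayleigh_solution \<omega> lam mu \<xi> \<psi> \<and>
    (\<forall>Z\<le>-H. \<psi> Z = exp (- (\<i> * of_real Z * q)) *s vector [w1, w2])"
proof -
  define e where "e = exp (- (\<i> * complex_of_real (- H) * q))"
  let ?y = "\<lambda>w s. exp (- (\<i> * complex_of_real s * q)) * w"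
  let ?z = "sol \<xi> (e * w1) (e * w2) (e * w3) (e * w4)"
  let ?g = "\<lambda>w i s. if s \<in> {..- H} then ?y w s else ?z i s"
  have "rayleigh_ode \<xi> {..0} (?g w1 1) (?g w2 2) (?g w3 3) (?g w4 4)"
    by (rule rayleigh_ode_glue[OF plane_wave_ode[OF eqs] sol_ode]) (simp_all add: sol_init e_def)
  then have "rayleigh_ode \<xi> {..<0} (?g w1 1) (?g w2 2) (?g w3 3) (?g w4 4)"
    by (rule rayleigh_ode_subset) auto
  then have "rayleigh_solution \<omega> lam mu \<xi> (\<lambda>s. vector [?g w1 1 s, ?g w2 2 s])"
    by (rule ode_imp_rayleigh_solution)
  moreover have "vector [?g w1 1 Z, ?g w2 2 Z] = exp (- (\<i> * of_real Z * q)) *s (vector [w1, w2] :: complex ^ 2)" if "Z \<le> - H" for Z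
    using that by (simp add: vec_eq_iff forall_2)
  ultimately show ?thesis by blast
qed

end

text \<open>Up to a factor this is the Wronskian of a solution and its conjugate: the derivative of
  v cnj u is b |v|^2 - k |u|^2, which is real because \<open>b\<close> and \<open>k\<close>
  are.\<close>

lemma Im_mult_cnj_constant:
  fixes u v :: "real \<Rightarrow> complex" and b :: "real \<Rightarrow> real"
  assumes u: "\<And>s. s \<in> {c..d} \<Longrightarrow> (u has_vector_derivative of_real (b s) * v s) (at s within {c..d})"
    and v: "\<And>s. s \<in> {c..d} \<Longrightarrow> (v has_vector_derivative - of_real k * u s) (at s within {c..d})"
    and "c \<le> d"
  shows "Im (v d * cnj (u d)) = Im (v c * cnj (u c))"
proof -
  have inner: "v s \<bullet> (\<i> * u s) = Im (v s * cnj (u s))" for s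
    by (simp add: inner_complex_def)
  have "((\<lambda>s. v s \<bullet> (\<i> * u s)) has_real_derivative 0) (at s within {c..d})" if s: "s \<in> {c..d}" for s
  proof -
    have "((\<lambda>s. v s \<bullet> (\<i> * u s)) has_vector_derivative
        v s \<bullet> (\<i> * (of_real (b s) * v s)) + (- of_real k * u s) \<bullet> (\<i> * u s)) (at s within {c..d})"
      by (intro bounded_bilinear.has_vector_derivative[OF bounded_bilinear_inner]
          has_vector_derivative_mult_right u v s)
    also have "v s \<bullet> (\<i> * (of_real (b s) * v s)) + (- of_real k * u s) \<bullet> (\<i> * u s) = 0"
      by (simp add: inner_complex_def)
    finally show ?thesis
      by (simp add: has_real_derivative_iff_has_vector_derivative)
  qed
  then obtain C where "\<And>s. s \<in> {c..d} \<Longrightarrow> v s \<bullet> (\<i> * u s) = C"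
    using has_field_derivative_zero_constant[of "{c..d}" "\<lambda>s. v s \<bullet> (\<i> * u s)"] by auto
  then show ?thesis
    using \<open>c \<le> d\<close> unfolding inner by auto
qed

lemma Re_nonzero_if_square_pos:
  assumes "q\<^sup>2 = complex_of_real r" "r > 0"
  shows "Re q \<noteq> 0"
proof
  assume "Re q = 0"
  then have "Re (q\<^sup>2) = - (Im q)\<^sup>2" by (simp add: power2_eq_square)
  then have "r = - (Im q)\<^sup>2" using assms(1) by simp
  then show False using assms(2) zero_le_power2[of "Im q"] by linarith
qed

text \<open>Pairing s with -s leaves A + B p, where A and B involve only the squares of p and s;
  pairing p with -p then leaves A^2 - p^2 B^2. The square roots disappear, so the product over the
  sheets is entire.\<close>

lemma sheet_product:
  fixes c0 c1 c2 c3 p s :: complex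
  shows "(c0 + c1 * p + c2 * s + c3 * p * s) * (c0 + c1 * p + c2 * - s + c3 * p * - s)
      * (c0 + c1 * - p + c2 * s + c3 * - p * s) * (c0 + c1 * - p + c2 * - s + c3 * - p * - s)
    = (c0\<^sup>2 + c1\<^sup>2 * p\<^sup>2 - s\<^sup>2 * (c2\<^sup>2 + c3\<^sup>2 * p\<^sup>2))\<^sup>2 - p\<^sup>2 * (2 * c0 * c1 - 2 * s\<^sup>2 * c2 * c3)\<^sup>2"
  by algebra

section \<open>Boundary tractions and the product over the four sheets\<close>

context rayleigh_medium
begin

lemma mu0_pos: "mu0 > 0" and sigma0_pos: "lam0 + 2 * mu0 > 0"
  using mu_pos[of "- H"] sigma_pos[of "- H"] mu_const_upto[of "- H"] lam_const_upto[of "- H"] H_pos by auto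

text \<open>In the new variables (lam + 2 mu) \<open>\<psi>\<^sub>2'\<close> + lam \<xi>
  \<open>\<psi>\<^sub>1\<close> is \<open>y3\<close> - 2 mu \<xi> \<open>y1\<close>; likewise the
  shear traction becomes \<open>y4\<close> - 2 mu \<xi> \<open>y2\<close>.\<close>

definition sol_traction_a :: "complex \<Rightarrow> complex \<Rightarrow> complex \<Rightarrow> complex \<Rightarrow> complex \<Rightarrow> complex" where
  "sol_traction_a \<xi> w1 w2 w3 w4 =
    \<i> * (sol \<xi> w1 w2 w3 w4 3 0 - 2 * of_real (mu 0) * \<xi> * sol \<xi> w1 w2 w3 w4 1 0)"

definition sol_traction_b :: "complex \<Rightarrow> complex \<Rightarrow> complex \<Rightarrow> complex \<Rightarrow> complex \<Rightarrow> complex" where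
  "sol_traction_b \<xi> w1 w2 w3 w4 =
    sol \<xi> w1 w2 w3 w4 4 0 - 2 * of_real (mu 0) * \<xi> * sol \<xi> w1 w2 w3 w4 2 0"

lemma tendsto_at_left_0: "(f \<longlongrightarrow> f 0) (at_left 0)" if "continuous_on {-H..0} f" for f :: "real \<Rightarrow> 'a::t2_space"
  using continuous_on_Icc_at_leftD[OF that] H_pos by simp

lemma left0_eqI: "(f \<longlongrightarrow> l) (at_left 0) \<Longrightarrow> left0 f = l"
  unfolding left0_def by (rule tendsto_Lim) auto

text \<open>Valid for every solution with the prescribed wave below -H, so the choice made by
  \<open>SOME\<close> is immaterial: by uniqueness the solution equals a \<open>sol\<close> on (-H,
  0), whose continuity up to 0 supplies the left limits. The exponential is the value of the scalar
  wave at -H.\<close>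

lemma traction_plane_wave:
  assumes sol: "rayleigh_solution \<omega> lam mu \<xi> \<psi>"
    and wave: "\<forall>Z\<le>-H. \<psi> Z = exp (- (\<i> * of_real Z * q)) *s vector [w1, w2]"
    and w3: "w3 = of_real (lam0 + 2 * mu0) * (- (\<i> * q) * w2 + \<xi> * w1)"
    and w4: "w4 = of_real mu0 * (- (\<i> * q) * w1 + \<xi> * w2)"
  shows "traction_a lam mu \<xi> \<psi> = exp (\<i> * of_real H * q) * sol_traction_a \<xi> w1 w2 w3 w4"
    and "traction_b mu \<xi> \<psi> = exp (\<i> * of_real H * q) * sol_traction_b \<xi> w1 w2 w3 w4"
proof -
  define e where "e = exp (- (\<i> * complex_of_real (- H) * q))"
  let ?S = "sol \<xi> (e * w1) (e * w2) (e * w3) (e * w4)"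
  define y3 where "y3 s = of_real (lam s + 2 * mu s) * (vderiv \<psi> s $ 2 + \<xi> * \<psi> s $ 1)" for s
  define y4 where "y4 s = of_real (mu s) * (vderiv \<psi> s $ 1 + \<xi> * \<psi> s $ 2)" for s
  have ode: "rayleigh_ode \<xi> {..<0} (\<lambda>s. \<psi> s $ 1) (\<lambda>s. \<psi> s $ 2) y3 y4"
    using rayleigh_solution_imp_ode[OF sol] unfolding y3_def y4_def .
  have deriv: "((\<lambda>s. \<psi> s $ i) has_vector_derivative vderiv \<psi> Z $ i) (at Z)" if "Z < 0" for Z i
  proof -
    have "(\<psi> has_vector_derivative vderiv \<psi> Z) (at Z)"
      using sol that unfolding rayleigh_solution_def vderiv_def by (simp add: vector_derivative_works)
    then show ?thesis unfolding has_vector_derivative_vec_nth_iff by blast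
  qed
  have init: "\<psi> (- H) $ 1 = e * w1" "\<psi> (- H) $ 2 = e * w2"
    using wave by (simp_all add: e_def)
  \<comment> \<open>The wave is known only for Z \<le> -H. Since the two-sided derivative exists, it
    can be computed from the left.\<close>
  have "vderiv \<psi> (- H) $ i = - (\<i> * q) * (e * vector [w1, w2] $ i)" for i :: 2
  proof (rule vector_derivative_unique_within[OF at_within_Iic_neq_bot[of "- H" "- H"]])
    show "((\<lambda>s. \<psi> s $ i) has_vector_derivative vderiv \<psi> (- H) $ i) (at (- H) within {..- H})"
      using H_pos by (intro has_vector_derivative_at_within[OF deriv]) simp
    have "((\<lambda>s. exp (- (\<i> * of_real s * q)) * vector [w1, w2] $ i) has_vector_derivative
        - (\<i> * q) * (e * vector [w1, w2] $ i)) (at (- H) within {..- H})"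
      unfolding e_def by (rule has_vector_derivative_plane_wave)
    then show "((\<lambda>s. \<psi> s $ i) has_vector_derivative - (\<i> * q) * (e * vector [w1, w2] $ i)) (at (- H) within {..- H})"
      by (rule has_vector_derivative_transform[rotated 2]) (use wave in auto)
  qed simp
  from this[of 1] this[of 2] have init': "y3 (- H) = e * w3" "y4 (- H) = e * w4"
    by (simp_all add: y3_def y4_def init w3 w4 lam_const_upto mu_const_upto algebra_simps)
  have eq: "\<psi> t $ 1 = ?S 1 t" "\<psi> t $ 2 = ?S 2 t" "y3 t = ?S 3 t" "y4 t = ?S 4 t" if t: "t \<in> {-H<..<0}" for t
  proof -
    have mem: "t \<in> {-H..0}" using t by auto
    have "rayleigh_ode \<xi> {-H..t} (\<lambda>s. \<psi> s $ 1) (\<lambda>s. \<psi> s $ 2) y3 y4"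
      by (rule rayleigh_ode_subset[OF ode]) (use t in auto)
    moreover have "rayleigh_ode \<xi> {-H..t} (?S 1) (?S 2) (?S 3) (?S 4)"
      by (rule rayleigh_ode_subset[OF sol_ode]) (use t in auto)
    ultimately show "\<psi> t $ 1 = ?S 1 t" "\<psi> t $ 2 = ?S 2 t" "y3 t = ?S 3 t" "y4 t = ?S 4 t"
      by (rule rayleigh_ode_unique[OF mem]; simp add: init init' sol_init)+
  qed
  have vd: "vderiv (\<lambda>s. \<psi> s $ i) Z = vderiv \<psi> Z $ i" if "Z < 0" for Z i
    using deriv[OF that] unfolding vderiv_def[of "\<lambda>s. \<psi> s $ i"] by (rule vector_derivative_at)
  have ev: "\<forall>\<^sub>F t in at_left 0. t \<in> {-H<..<0}"
    using H_pos by (intro eventually_at_left_real) simp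
  have cont: "continuous_on {-H..0} lam" "continuous_on {-H..0} mu"
    by (auto intro: continuous_on_subset[OF lam_cont] continuous_on_subset[OF mu_cont])
  have lim: "(lam \<longlongrightarrow> lam 0) (at_left 0)" "(mu \<longlongrightarrow> mu 0) (at_left 0)" "(?S i \<longlongrightarrow> ?S i 0) (at_left 0)" for i
    by (intro tendsto_at_left_0 cont sol_continuous)+
  have nz: "mu t \<noteq> 0" "lam t + 2 * mu t \<noteq> 0" if "t \<le> 0" for t
    using mu_pos[OF that] sigma_pos[OF that] by auto
  have left: "left0 lam = lam 0" "left0 mu = mu 0"
    by (intro left0_eqI lim)+
  have left1: "left0 (\<lambda>Z. \<psi> Z $ 1) = ?S 1 0"
    by (rule left0_eqI, rule Lim_transform_eventually[OF lim(3)[of 1]])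
      (use ev in eventually_elim, simp add: eq)
  have left2: "left0 (\<lambda>Z. \<psi> Z $ 2) = ?S 2 0"
    by (rule left0_eqI, rule Lim_transform_eventually[OF lim(3)[of 2]])
      (use ev in eventually_elim, simp add: eq)
  have left3: "left0 (\<lambda>Z. vderiv (\<lambda>t. \<psi> t $ 2) Z) = ?S 3 0 / of_real (lam 0 + 2 * mu 0) - \<xi> * ?S 1 0"
  proof (rule left0_eqI, rule Lim_transform_eventually)
    show "((\<lambda>t. ?S 3 t / of_real (lam t + 2 * mu t) - \<xi> * ?S 1 t)
        \<longlongrightarrow> ?S 3 0 / of_real (lam 0 + 2 * mu 0) - \<xi> * ?S 1 0) (at_left 0)"
      by (intro tendsto_intros lim) (use nz(2)[of 0] in \<open>simp del: of_real_add of_real_mult\<close>)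
    show "\<forall>\<^sub>F t in at_left 0. ?S 3 t / of_real (lam t + 2 * mu t) - \<xi> * ?S 1 t = vderiv (\<lambda>t. \<psi> t $ 2) t"
      using ev
    proof eventually_elim
      case (elim t)
      then show ?case
        using nz(2)[of t] unfolding eq(1)[OF elim, symmetric] eq(3)[OF elim, symmetric] y3_def
        by (simp add: vd del: of_real_add of_real_mult)
    qed
  qed
  have left4: "left0 (\<lambda>Z. vderiv (\<lambda>t. \<psi> t $ 1) Z) = ?S 4 0 / of_real (mu 0) - \<xi> * ?S 2 0"
  proof (rule left0_eqI, rule Lim_transform_eventually)
    show "((\<lambda>t. ?S 4 t / of_real (mu t) - \<xi> * ?S 2 t) \<longlongrightarrow> ?S 4 0 / of_real (mu 0) - \<xi> * ?S 2 0) (at_left 0)"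
      by (intro tendsto_intros lim) (use nz(1)[of 0] in simp)
    show "\<forall>\<^sub>F t in at_left 0. ?S 4 t / of_real (mu t) - \<xi> * ?S 2 t = vderiv (\<lambda>t. \<psi> t $ 1) t"
      using ev
    proof eventually_elim
      case (elim t)
      then show ?case
        using nz(1)[of t] unfolding eq(2)[OF elim, symmetric] eq(4)[OF elim, symmetric] y4_def
        by (simp add: vd)
    qed
  qed
  have e: "e = exp (\<i> * of_real H * q)"
    by (simp add: e_def)
  have "traction_a lam mu \<xi> \<psi> = \<i> * (?S 3 0 - 2 * of_real (mu 0) * \<xi> * ?S 1 0)"
    using nz(2)[of 0] unfolding traction_a_def left left1 left3
    by (simp add: right_diff_distrib del: of_real_add of_real_mult) (simp add: algebra_simps)
  then show "traction_a lam mu \<xi> \<psi> = exp (\<i> * of_real H * q) * sol_traction_a \<xi> w1 w2 w3 w4"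
    unfolding sol_scale sol_traction_a_def e[symmetric] by (simp add: algebra_simps)
  have "traction_b mu \<xi> \<psi> = ?S 4 0 - 2 * of_real (mu 0) * \<xi> * ?S 2 0"
    using nz(1)[of 0] unfolding traction_b_def left left2 left4
    by (simp add: right_diff_distrib)
  then show "traction_b mu \<xi> \<psi> = exp (\<i> * of_real H * q) * sol_traction_b \<xi> w1 w2 w3 w4"
    unfolding sol_scale sol_traction_b_def e[symmetric] by (simp add: algebra_simps)
qed

text \<open>The boundary determinant without the exponentials. The last two initial entries come
  from the dispersion relations: for the P wave \<open>y3\<close> is -(lam0 + 2 mu0) (qP^2 +
  \<xi>^2), that is \<open>- \<omega>\<^sup>2\<close>, and \<open>y4\<close> is 0; for the S wave
  the roles are exchanged.\<close>

definition reduced_det :: "complex \<Rightarrow> complex \<Rightarrow> complex \<Rightarrow> complex" where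
  "reduced_det \<xi> qP qS =
    sol_traction_a \<xi> (- \<xi>) (- (\<i> * qP)) (- of_real (\<omega>\<^sup>2)) 0 * sol_traction_b \<xi> (- (\<i> * qS)) (- \<xi>) 0 (- of_real (\<omega>\<^sup>2))
    - sol_traction_a \<xi> (- (\<i> * qS)) (- \<xi>) 0 (- of_real (\<omega>\<^sup>2)) * sol_traction_b \<xi> (- \<xi>) (- (\<i> * qP)) (- of_real (\<omega>\<^sup>2)) 0"

lemma rayleigh_det_eq:
  assumes "(\<xi>, qP, qS) \<in> riemann_surface \<omega> lam0 mu0"
  shows "rayleigh_det \<omega> H lam mu (\<xi>, qP, qS)
    = exp (\<i> * of_real H * qP) * exp (\<i> * of_real H * qS) * reduced_det \<xi> qP qS"
proof -
  define sg where "sg = complex_of_real (lam0 + 2 * mu0)"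
  define W where "W = complex_of_real (\<omega>\<^sup>2)"
  have sg: "sg \<noteq> 0" and m: "complex_of_real mu0 \<noteq> 0"
    using sigma0_pos mu0_pos by (simp_all add: sg_def del: of_real_add of_real_mult)
  have qP: "qP * qP = W / sg - \<xi> * \<xi>" and qS: "qS * qS = W / of_real mu0 - \<xi> * \<xi>"
    using assms unfolding riemann_surface_def sg_def W_def
    by (simp_all add: power2_eq_square)
  have "\<exists>\<psi>. rayleigh_solution \<omega> lam mu \<xi> \<psi> \<and>
     (\<forall>Z\<le>-H. \<psi> Z = exp (- (\<i> * of_real Z * qP)) *s vector [- \<xi>, - (\<i> * qP)])"
  proof (rule jost_solution_exists[where ?w3.0 = "- W" and ?w4.0 = 0])
    show "- (\<i> * qP) * - \<xi> = - \<xi> * - (\<i> * qP) + complex_of_real (1 / mu0) * 0" by simp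
    have "- (\<i> * qP) * - (\<i> * qP) = - (qP * qP)" by (simp add: mult.assoc mult.left_commute)
    then show "- (\<i> * qP) * - (\<i> * qP) = - \<xi> * - \<xi> + complex_of_real (1 / (lam0 + 2 * mu0)) * - W"
      unfolding qP by (simp add: sg_def)
  qed (simp_all add: W_def)
  from someI_ex[OF this] have P: "rayleigh_solution \<omega> lam mu \<xi> (jost_P_minus \<omega> H lam mu (\<xi>, qP, qS)) \<and>
     (\<forall>Z\<le>-H. jost_P_minus \<omega> H lam mu (\<xi>, qP, qS) Z = exp (- (\<i> * of_real Z * qP)) *s vector [- \<xi>, - (\<i> * qP)])"
    unfolding jost_P_minus.simps .
  have "\<exists>\<psi>. rayleigh_solution \<omega> lam mu \<xi> \<psi> \<and>
     (\<forall>Z\<le>-H. \<psi> Z = exp (- (\<i> * of_real Z * qS)) *s vector [- (\<i> * qS), - \<xi>])"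
  proof (rule jost_solution_exists[where ?w3.0 = 0 and ?w4.0 = "- W"])
    show "- (\<i> * qS) * - \<xi> = - \<xi> * - (\<i> * qS) + complex_of_real (1 / (lam0 + 2 * mu0)) * 0" by simp
    have "- (\<i> * qS) * - (\<i> * qS) = - (qS * qS)" by (simp add: mult.assoc mult.left_commute)
    then show "- (\<i> * qS) * - (\<i> * qS) = - \<xi> * - \<xi> + complex_of_real (1 / mu0) * - W"
      unfolding qS by simp
  qed (simp_all add: W_def)
  from someI_ex[OF this] have S: "rayleigh_solution \<omega> lam mu \<xi> (jost_S_minus \<omega> H lam mu (\<xi>, qP, qS)) \<and>
     (\<forall>Z\<le>-H. jost_S_minus \<omega> H lam mu (\<xi>, qP, qS) Z = exp (- (\<i> * of_real Z * qS)) *s vector [- (\<i> * qS), - \<xi>])"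
    unfolding jost_S_minus.simps .
  have wP: "- W = of_real (lam0 + 2 * mu0) * (- (\<i> * qP) * - (\<i> * qP) + \<xi> * - \<xi>)"
    "0 = of_real mu0 * (- (\<i> * qP) * - \<xi> + \<xi> * - (\<i> * qP))"
  proof -
    have "- (\<i> * qP) * - (\<i> * qP) = - (qP * qP)" by (simp add: mult.assoc mult.left_commute)
    then show "- W = of_real (lam0 + 2 * mu0) * (- (\<i> * qP) * - (\<i> * qP) + \<xi> * - \<xi>)"
      unfolding qP sg_def[symmetric] using sg by simp
  qed simp
  have wS: "0 = of_real (lam0 + 2 * mu0) * (- (\<i> * qS) * - \<xi> + \<xi> * - (\<i> * qS))"
    "- W = of_real mu0 * (- (\<i> * qS) * - (\<i> * qS) + \<xi> * - \<xi>)"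
  proof -
    have "- (\<i> * qS) * - (\<i> * qS) = - (qS * qS)" by (simp add: mult.assoc mult.left_commute)
    then show "- W = of_real mu0 * (- (\<i> * qS) * - (\<i> * qS) + \<xi> * - \<xi>)"
      unfolding qS using m by simp
  qed simp
  note tP = traction_plane_wave[OF P[THEN conjunct1] P[THEN conjunct2] wP]
  note tS = traction_plane_wave[OF S[THEN conjunct1] S[THEN conjunct2] wS]
  show ?thesis
    unfolding rayleigh_det_def boundary_matrix_def Let_def fst_conv det_2 vector_2 tP tS
      reduced_det_def W_def[symmetric]
    by (simp add: algebra_simps)
qed

lemma sheets_in_riemann_surface:
  assumes "(\<xi>, qP, qS) \<in> riemann_surface \<omega> lam0 mu0"
  shows "(\<xi>, qP, - qS) \<in> riemann_surface \<omega> lam0 mu0" "(\<xi>, - qP, qS) \<in> riemann_surface \<omega> lam0 mu0"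
    "(\<xi>, - qP, - qS) \<in> riemann_surface \<omega> lam0 mu0"
  using assms by (simp_all add: riemann_surface_def)

lemma csqrt_in_riemann_surface:
  "(\<xi>, csqrt (of_real (\<omega>\<^sup>2 / (lam0 + 2 * mu0)) - \<xi>\<^sup>2), csqrt (of_real (\<omega>\<^sup>2 / mu0) - \<xi>\<^sup>2))
    \<in> riemann_surface \<omega> lam0 mu0"
  by (simp add: riemann_surface_def)

text \<open>Over the four sheets the exponentials in \<open>qP\<close> and \<open>qS\<close> occur
  equally often with either sign and cancel, so \<open>qP\<close> and \<open>qS\<close> remain only
  polynomially.\<close>

lemma rayleigh_F_reduced:
  assumes "(\<xi>, qP, qS) \<in> riemann_surface \<omega> lam0 mu0"
  shows "rayleigh_F \<omega> H lam0 mu0 lam mu \<xi> =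
    reduced_det \<xi> qP qS * reduced_det \<xi> qP (- qS) * reduced_det \<xi> (- qP) qS * reduced_det \<xi> (- qP) (- qS)"
proof -
  have cancel: "exp (\<i> * of_real H * - q) = inverse (exp (\<i> * of_real H * q))" for q
    by (simp add: exp_minus)
  show ?thesis
    using rayleigh_F_eq[OF assms, of H lam mu]
    unfolding fst_conv w_P.simps w_S.simps w_PS.simps rayleigh_det_eq[OF assms]
      sheets_in_riemann_surface[OF assms, THEN rayleigh_det_eq] cancel
    by (simp add: field_simps)
qed

text \<open>Tractions of the k-th basis solution. With \<open>coef_b\<close> these are the only
  transcendental ingredients of \<open>rayleigh_F\<close>.\<close>

definition coef_a :: "4 \<Rightarrow> complex \<Rightarrow> complex" where
  "coef_a k \<xi> = \<i> * (fund \<xi> k 3 0 - 2 * of_real (mu 0) * \<xi> * fund \<xi> k 1 0)"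

definition coef_b :: "4 \<Rightarrow> complex \<Rightarrow> complex" where
  "coef_b k \<xi> = fund \<xi> k 4 0 - 2 * of_real (mu 0) * \<xi> * fund \<xi> k 2 0"

lemma sol_traction_coef:
  "sol_traction_a \<xi> w1 w2 w3 w4 = w1 * coef_a 1 \<xi> + w2 * coef_a 2 \<xi> + w3 * coef_a 3 \<xi> + w4 * coef_a 4 \<xi>"
  "sol_traction_b \<xi> w1 w2 w3 w4 = w1 * coef_b 1 \<xi> + w2 * coef_b 2 \<xi> + w3 * coef_b 3 \<xi> + w4 * coef_b 4 \<xi>"
  by (simp_all add: sol_traction_a_def sol_traction_b_def coef_a_def coef_b_def sol_def algebra_simps)

lemma coef_holomorphic: "coef_a k holomorphic_on UNIV" "coef_b k holomorphic_on UNIV"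
  unfolding coef_a_def coef_b_def using H_pos by (intro holomorphic_intros fund_holomorphic; simp)+

lemma coef_tame: "tame (coef_a k)" "tame (coef_b k)"
  unfolding coef_a_def coef_b_def by (intro tame_intros fund_tame)+

lemma rayleigh_F_entire_tame:
  "rayleigh_F \<omega> H lam0 mu0 lam mu holomorphic_on UNIV \<and> tame (rayleigh_F \<omega> H lam0 mu0 lam mu)"
proof -
  \<comment> \<open>The columns of the determinant are (A1 + A2 qP, B1 + B2 qP) and (A3 + A4 qS, B3
    + B4 qS); expanding gives the coefficients \<open>c0\<close> to \<open>c3\<close> of 1, qP, qS
    and qP qS.\<close>
  define A1 where "A1 \<xi> = - \<xi> * coef_a 1 \<xi> - of_real (\<omega>\<^sup>2) * coef_a 3 \<xi>" for \<xi>
  define A2 where "A2 \<xi> = - \<i> * coef_a 2 \<xi>" for \<xi>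
  define A3 where "A3 \<xi> = - \<xi> * coef_a 2 \<xi> - of_real (\<omega>\<^sup>2) * coef_a 4 \<xi>" for \<xi>
  define A4 where "A4 \<xi> = - \<i> * coef_a 1 \<xi>" for \<xi>
  define B1 where "B1 \<xi> = - \<xi> * coef_b 1 \<xi> - of_real (\<omega>\<^sup>2) * coef_b 3 \<xi>" for \<xi>
  define B2 where "B2 \<xi> = - \<i> * coef_b 2 \<xi>" for \<xi>
  define B3 where "B3 \<xi> = - \<xi> * coef_b 2 \<xi> - of_real (\<omega>\<^sup>2) * coef_b 4 \<xi>" for \<xi>
  define B4 where "B4 \<xi> = - \<i> * coef_b 1 \<xi>" for \<xi>
  define c0 where "c0 \<xi> = A1 \<xi> * B3 \<xi> - A3 \<xi> * B1 \<xi>" for \<xi>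
  define c1 where "c1 \<xi> = A2 \<xi> * B3 \<xi> - A3 \<xi> * B2 \<xi>" for \<xi>
  define c2 where "c2 \<xi> = A1 \<xi> * B4 \<xi> - A4 \<xi> * B1 \<xi>" for \<xi>
  define c3 where "c3 \<xi> = A2 \<xi> * B4 \<xi> - A4 \<xi> * B2 \<xi>" for \<xi>
  define P where "P \<xi> = of_real (\<omega>\<^sup>2 / (lam0 + 2 * mu0)) - \<xi>\<^sup>2" for \<xi> :: complex
  define S where "S \<xi> = of_real (\<omega>\<^sup>2 / mu0) - \<xi>\<^sup>2" for \<xi> :: complex
  have red: "reduced_det \<xi> qP qS = c0 \<xi> + c1 \<xi> * qP + c2 \<xi> * qS + c3 \<xi> * qP * qS" for \<xi> qP qS
    unfolding reduced_det_def sol_traction_coef c0_def c1_def c2_def c3_def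
      A1_def A2_def A3_def A4_def B1_def B2_def B3_def B4_def
    by (simp add: algebra_simps)
  have F: "rayleigh_F \<omega> H lam0 mu0 lam mu =
      (\<lambda>\<xi>. ((c0 \<xi>)\<^sup>2 + (c1 \<xi>)\<^sup>2 * P \<xi> - S \<xi> * ((c2 \<xi>)\<^sup>2 + (c3 \<xi>)\<^sup>2 * P \<xi>))\<^sup>2
        - P \<xi> * (2 * c0 \<xi> * c1 \<xi> - 2 * S \<xi> * c2 \<xi> * c3 \<xi>)\<^sup>2)"
  proof
    fix \<xi>
    have sq: "(csqrt (P \<xi>))\<^sup>2 = P \<xi>" "(csqrt (S \<xi>))\<^sup>2 = S \<xi>" by simp_all
    show "rayleigh_F \<omega> H lam0 mu0 lam mu \<xi> =
      ((c0 \<xi>)\<^sup>2 + (c1 \<xi>)\<^sup>2 * P \<xi> - S \<xi> * ((c2 \<xi>)\<^sup>2 + (c3 \<xi>)\<^sup>2 * P \<xi>))\<^sup>2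
        - P \<xi> * (2 * c0 \<xi> * c1 \<xi> - 2 * S \<xi> * c2 \<xi> * c3 \<xi>)\<^sup>2"
      unfolding rayleigh_F_reduced[OF csqrt_in_riemann_surface] red P_def[symmetric] S_def[symmetric]
      by (simp only: sheet_product sq)
  qed
  show ?thesis
  proof
    show "rayleigh_F \<omega> H lam0 mu0 lam mu holomorphic_on UNIV"
      unfolding F c0_def c1_def c2_def c3_def A1_def A2_def A3_def A4_def B1_def B2_def B3_def B4_def P_def S_def
      by (intro holomorphic_intros coef_holomorphic)
    have AB: "tame A1" "tame A2" "tame A3" "tame A4" "tame B1" "tame B2" "tame B3" "tame B4"
      unfolding A1_def A2_def A3_def A4_def B1_def B2_def B3_def B4_def by (intro tame_intros coef_tame)+
    have "tame c0" "tame c1" "tame c2" "tame c3" "tame P" "tame S"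
      unfolding c0_def c1_def c2_def c3_def P_def S_def by (intro tame_intros AB)+
    then show "tame (rayleigh_F \<omega> H lam0 mu0 lam mu)"
      unfolding F by (intro tame_intros)
  qed
qed

text \<open>At \<open>\<xi> = 0\<close> the system decouples into two scalar Sturm-Liouville equations with real
  coefficients, and \<open>\<psi>\<^sub>P\<^sup>-\<close>, \<open>\<psi>\<^sub>S\<^sup>-\<close> solve one each. The flux \<open>Im (p u' * cnj u)\<close> of such a solution is
  constant and nonzero, so its boundary traction cannot vanish.\<close>

lemma reduced_det_0_nonzero:
  assumes "Re qP \<noteq> 0" "Re qS \<noteq> 0"
  shows "reduced_det 0 qP qS \<noteq> 0"
proof -
  define W where "W = complex_of_real (\<omega>\<^sup>2)"
  let ?P = "sol 0 0 (- (\<i> * qP)) (- W) 0"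
  let ?S = "sol 0 (- (\<i> * qS)) 0 0 (- W)"
  have sub: "rayleigh_ode 0 {-H..0} (?P 1) (?P 2) (?P 3) (?P 4)" "rayleigh_ode 0 {-H..0} (?S 1) (?S 2) (?S 3) (?S 4)"
    by (rule sol_ode)+
  \<comment> \<open>At \<xi> = 0 the pair \<open>y1\<close>, \<open>y4\<close> does not interact
    with \<open>y2\<close>, \<open>y3\<close>. Replacing the latter by 0 gives a second solution
    with the same initial data, so uniqueness forces them to vanish and the determinant becomes
    triangular.\<close>
  have S_ode: "rayleigh_ode 0 {-H..0} (?S 1) (\<lambda>_. 0) (\<lambda>_. 0) (?S 4)"
    using sub(2) unfolding rayleigh_ode_def by simp
  have "?S 3 0 = 0"
    by (rule rayleigh_ode_unique(3)[OF _ sub(2) S_ode]) (use H_pos in \<open>simp_all add: sol_init\<close>)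
  have "Im (?P 3 0 * cnj (?P 2 0)) = Im (?P 3 (- H) * cnj (?P 2 (- H)))"
    by (rule Im_mult_cnj_constant[where b = "\<lambda>s. 1 / (lam s + 2 * mu s)" and k = "\<omega>\<^sup>2"])
      (use sub(1) H_pos in \<open>simp_all add: rayleigh_ode_def\<close>)
  \<comment> \<open>At -H the flux equals \<open>- \<omega>\<^sup>2 * Re qP\<close>.\<close>
  also have "\<dots> \<noteq> 0"
    using assms(1) \<omega>_pos by (simp add: sol_init W_def)
  finally have "?P 3 0 \<noteq> 0" by auto
  have "Im (?S 4 0 * cnj (?S 1 0)) = Im (?S 4 (- H) * cnj (?S 1 (- H)))"
    by (rule Im_mult_cnj_constant[where b = "\<lambda>s. 1 / mu s" and k = "\<omega>\<^sup>2"])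
      (use sub(2) H_pos in \<open>simp_all add: rayleigh_ode_def\<close>)
  also have "\<dots> \<noteq> 0"
    using assms(2) \<omega>_pos by (simp add: sol_init W_def)
  finally have "?S 4 0 \<noteq> 0" by auto
  have "reduced_det 0 qP qS = \<i> * ?P 3 0 * ?S 4 0 - \<i> * ?S 3 0 * ?P 4 0"
    by (simp add: reduced_det_def sol_traction_a_def sol_traction_b_def W_def)
  then show ?thesis
    using \<open>?S 3 0 = 0\<close> \<open>?P 3 0 \<noteq> 0\<close> \<open>?S 4 0 \<noteq> 0\<close> by simp
qed

text \<open>At \<xi> = 0 the squares of \<open>qP\<close> and \<open>qS\<close> are positive, so
  both roots have nonzero real part with either sign and none of the four factors vanishes.\<close>

lemma rayleigh_F_0_nonzero: "rayleigh_F \<omega> H lam0 mu0 lam mu 0 \<noteq> 0"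
proof -
  define qP where "qP = csqrt (of_real (\<omega>\<^sup>2 / (lam0 + 2 * mu0)) - 0\<^sup>2)"
  define qS where "qS = csqrt (of_real (\<omega>\<^sup>2 / mu0) - 0\<^sup>2)"
  have "Re qP \<noteq> 0"
    by (rule Re_nonzero_if_square_pos[of _ "\<omega>\<^sup>2 / (lam0 + 2 * mu0)"])
      (unfold qP_def power2_csqrt, use sigma0_pos \<omega>_pos in simp_all)
  moreover have "Re qS \<noteq> 0"
    by (rule Re_nonzero_if_square_pos[of _ "\<omega>\<^sup>2 / mu0"])
      (unfold qS_def power2_csqrt, use mu0_pos \<omega>_pos in simp_all)
  ultimately show ?thesis
    unfolding rayleigh_F_reduced[OF csqrt_in_riemann_surface] qP_def[symmetric] qS_def[symmetric]
    by (simp add: reduced_det_0_nonzero)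
qed

end

theorem mainTheorem1:
  fixes \<omega> H \<alpha>0 \<beta>0 lam0 mu0 :: real
    and lam mu :: "real \<Rightarrow> real"
  assumes "\<omega> > 0" and "H > 0"
    and "C3_on {..0} lam" and "C3_on {..0} mu"
    and "\<alpha>0 > 0" and "\<And>Z. Z \<le> 0 \<Longrightarrow> mu Z \<ge> \<alpha>0"
    and "\<beta>0 > 0" and "\<And>Z. Z \<le> 0 \<Longrightarrow> 2 * mu Z + 3 * lam Z \<ge> \<beta>0"
    and "\<And>Z. Z < -H \<Longrightarrow> lam Z = lam0" and "\<And>Z. Z < -H \<Longrightarrow> mu Z = mu0"
  defines "F \<equiv> rayleigh_F \<omega> H lam0 mu0 lam mu"
  shows "(\<lambda>z. real_of_int (zorder F z) * (\<bar>Re z\<bar> / (cmod z)\<^sup>2))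
           summable_on {z. z \<noteq> 0 \<and> F z = 0}"
proof -
  obtain lam' where lam': "\<forall>x\<in>{..0}. (lam has_real_derivative lam' x) (at x within {..0})"
    using assms(3) unfolding C3_on_def by blast
  obtain mu' mu'' where mu': "\<forall>x\<in>{..0}. (mu has_real_derivative mu' x) (at x within {..0})"
    "\<forall>x\<in>{..0}. (mu' has_real_derivative mu'' x) (at x within {..0})"
    using assms(4) unfolding C3_on_def by blast
  interpret rayleigh_medium \<omega> H lam0 mu0 lam mu lam' mu'
  proof
    \<comment> \<open>3 (lam + 2 mu) is (2 mu + 3 lam) + 4 mu, a sum of two positive terms.\<close>
    show "mu Z > 0" "lam Z + 2 * mu Z > 0" if "Z \<le> 0" for Z
      using assms(5,7) assms(6)[OF that] assms(8)[OF that] by linarith+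
    show "continuous_on {..0} mu'"
      using mu'(2) by (intro DERIV_continuous_on) auto
  qed (use assms lam' mu' in auto)
  have "{z. z \<noteq> 0 \<and> F z = 0} = {z. F z = 0}"
    using rayleigh_F_0_nonzero unfolding F_def by auto
  then show ?thesis
    using tame_zeros_summable[of F] rayleigh_F_entire_tame rayleigh_F_0_nonzero unfolding F_def by simp
qed

end
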